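(* Let $G$ be a finite group, let $p$ be a prime and $k$ a positive integer with $p^k$ dividing $|G|$. Assume that $G\in\mathcal{M}(p^k)$ is of critical type, i.e. $G\in\mathcal{M}(p^k)$, $k\ge 2$, $\mathbf{O}_{p'}(G)=1$ and $|\Phi(G)|=p^{k-1}$. Then one and only one of the following holds. (1) $G=H\ltimes P$ for some subgroup $H$ and normal subgroup $P$ of $G$, where $H$ is isomorphic to a subgroup of $C_{p-1}$ and $P=\mathbf{C}_G(P)\cong C_{p^k}$; (2) $p^k=2^2$ and $G\cong Q_8$.
   Context: All groups are finite. $\Phi(X)$ denotes the Frattini subgroup of $X$, $\mathbf{O}_{p'}(X)$ the largest normal subgroup of $X$ of order prime to $p$, $\mathbf{C}_G(P)$ the centralizer of $P$ in $G$, $C_n$ the cyclic group of order $n$, and $Q_8$ the quaternion group of order $8$. $A<B$ means that $A$ is a proper subgroup of $B$. A subgroup $H$ of $G$ is $\mathcal{M}$-supplemented in $G$ if there exists a subgroup $K$ of $G$ such that $G=HK$ and $H_iK<G$ (that is, $H_iK$ is a proper subgroup of $G$) for every maximal subgroup $H_i$ of $H$. For a prime power $p^k$ with $p\le p^k\le |G|_p$, where $|G|_p$ is the order of a Sylow $p$-subgroup of $G$, we write $G\in\mathcal{M}(p^k)$ if all subgroups of $G$ of order $p^k$ are $\mathcal{M}$-supplemented in $G$. *)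

theory Defs
  imports "HOL-Algebra.Algebra"
begin

definition maximal_subgroup :: "'a set \<Rightarrow> ('a, 'b) monoid_scheme \<Rightarrow> bool" where
  "maximal_subgroup M G \<longleftrightarrow>
     subgroup M G \<and> M \<noteq> carrier G \<and>
     (\<forall>K. subgroup K G \<and> M \<subset> K \<longrightarrow> K = carrier G)"

text \<open>Intersecting with the carrier makes the Frattini subgroup of the trivial group, which has no
  maximal subgroups, the whole group.\<close>

definition frattini :: "('a, 'b) monoid_scheme \<Rightarrow> 'a set" where
  "frattini G = carrier G \<inter> \<Inter> {M. maximal_subgroup M G}"

definition centralizer :: "('a, 'b) monoid_scheme \<Rightarrow> 'a set \<Rightarrow> 'a set" where
  "centralizer G P = {g \<in> carrier G. \<forall>x\<in>P. g \<otimes>\<^bsub>G\<^esub> x = x \<otimes>\<^bsub>G\<^esub> g}"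

text \<open>The greatest element is taken with respect to inclusion; \<open>p_prime_core_greatest\<close> below shows
  that it exists in every finite group.\<close>

definition p_prime_core :: "nat \<Rightarrow> ('a, 'b) monoid_scheme \<Rightarrow> 'a set" where
  "p_prime_core p G = (GREATEST N. N \<lhd> G \<and> coprime (card N) p)"

lemma (in group) card_normal_set_mult_dvd:
  assumes "N \<lhd> G" and "subgroup M G"
  shows "card (N <#> M) dvd card N * card M"
proof -
  let ?NM = "G\<lparr>carrier := N <#> M\<rparr>" and ?M = "G\<lparr>carrier := M\<rparr>"
  interpret NM: group ?NM
    using mult_norm_subgroup[OF assms] subgroup_imp_group by blast
  interpret M: group ?M
    using assms(2) subgroup_imp_group by blast
  have sub: "subgroup (N \<inter> M) ?M"
    using subgroup_incl[OF subgroups_Inter_pair[OF normal_imp_subgroup[OF assms(1)] assms(2)] assms(2)]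
    by simp
  have "subgroup N ?NM"
    using normal_in_normal_set_mult[OF assms] normal_imp_subgroup by blast
  then have 1: "card (rcosets\<^bsub>?NM\<^esub> N) * card N = card (N <#> M)"
    using NM.lagrange by (simp add: order_def)
  have 2: "card (rcosets\<^bsub>?M\<^esub> (N \<inter> M)) * card (N \<inter> M) = card M"
    using M.lagrange[OF sub] by (simp add: order_def)
  have "?NM Mod N \<cong> ?M Mod (N \<inter> M)"
    using weak_snd_iso_thme[OF assms(2,1)] .
  from iso_same_card[OF this]
  have 3: "card (rcosets\<^bsub>?NM\<^esub> N) = card (rcosets\<^bsub>?M\<^esub> (N \<inter> M))"
    by (simp only: FactGroup_def partial_object.simps)
  show ?thesis
    unfolding 1[symmetric] 2[symmetric] 3 by simp
qed

lemma (in group) subset_set_mult_right: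
  assumes "A \<subseteq> carrier G" and "subgroup B G"
  shows "A \<subseteq> A <#> B"
proof
  fix x assume x: "x \<in> A"
  have "x \<otimes> \<one> \<in> A <#> B"
    unfolding set_mult_def using x subgroup.one_closed[OF assms(2)] by blast
  then show "x \<in> A <#> B" using x assms(1) by (simp add: subsetD)
qed

lemma (in group) subset_set_mult_left:
  assumes "A \<subseteq> carrier G" and "subgroup B G"
  shows "A \<subseteq> B <#> A"
proof
  fix x assume x: "x \<in> A"
  have "\<one> \<otimes> x \<in> B <#> A"
    unfolding set_mult_def using x subgroup.one_closed[OF assms(2)] by blast
  then show "x \<in> B <#> A" using x assms(1) by (simp add: subsetD)
qed

lemma (in group) p_prime_core_greatest:
  assumes "finite (carrier G)"
  shows "p_prime_core p G \<lhd> G" and "coprime (card (p_prime_core p G)) p"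
    and "\<And>M. M \<lhd> G \<Longrightarrow> coprime (card M) p \<Longrightarrow> M \<subseteq> p_prime_core p G"
proof -
  let ?P = "\<lambda>N. N \<lhd> G \<and> coprime (card N) p"
  have sub: "N \<subseteq> carrier G" if "N \<lhd> G" for N
    using that normal_imp_subgroup subgroup.subset by blast
  have "?P {\<one>}"
    using one_is_normal by simp
  moreover have "\<forall>N. ?P N \<longrightarrow> card N < Suc (order G)"
    using assms sub by (auto simp: order_def less_Suc_eq_le intro: card_mono)
  ultimately obtain N where N: "?P N" and max: "\<And>M. ?P M \<Longrightarrow> card M \<le> card N"
    using ex_has_greatest_nat[of ?P "{\<one>}" card "Suc (order G)"] by auto
  have le: "M \<subseteq> N" if M: "?P M" for M
  proof -
    have sgs: "subgroup N G" "subgroup M G"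
      using N M normal_imp_subgroup by blast+
    have nm: "N <#> M \<lhd> G"
      using N M normal_subgroup_set_mult_closed by blast
    have "coprime (card N * card M) p"
      using N M by simp
    then have "coprime (card (N <#> M)) p"
      using coprime_divisors[OF card_normal_set_mult_dvd[of N M] dvd_refl] N sgs by blast
    then have "card (N <#> M) \<le> card N"
      using max nm by blast
    moreover have "N \<subseteq> N <#> M"
      using sub N sgs(2) by (intro subset_set_mult_right) auto
    moreover have "finite (N <#> M)"
      using sub[OF nm] assms finite_subset by blast
    ultimately have "N = N <#> M"
      using card_seteq by blast
    moreover have "M \<subseteq> N <#> M"
      using sub M sgs(1) by (intro subset_set_mult_left) auto
    ultimately show ?thesis by simp
  qed
  have eq: "p_prime_core p G = N"
    unfolding p_prime_core_def using N le by (intro Greatest_equality) auto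
  show "p_prime_core p G \<lhd> G" "coprime (card (p_prime_core p G)) p"
    "\<And>M. M \<lhd> G \<Longrightarrow> coprime (card M) p \<Longrightarrow> M \<subseteq> p_prime_core p G"
    using N le by (auto simp: eq)
qed

definition M_supplemented :: "'a set \<Rightarrow> ('a, 'b) monoid_scheme \<Rightarrow> bool" where
  "M_supplemented H G \<longleftrightarrow>
     (\<exists>K. subgroup K G \<and> H <#>\<^bsub>G\<^esub> K = carrier G \<and>
        (\<forall>H'. maximal_subgroup H' (G\<lparr>carrier := H\<rparr>) \<longrightarrow>
           subgroup (H' <#>\<^bsub>G\<^esub> K) G \<and> H' <#>\<^bsub>G\<^esub> K \<noteq> carrier G))"

text \<open>The range condition on the prime power \<open>n = p ^ k\<close> is left to the user of this predicate.\<close>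

definition M_class :: "nat \<Rightarrow> ('a, 'b) monoid_scheme \<Rightarrow> bool" where
  "M_class n G \<longleftrightarrow> (\<forall>H. subgroup H G \<and> card H = n \<longrightarrow> M_supplemented H G)"

definition critical_type :: "nat \<Rightarrow> nat \<Rightarrow> ('a, 'b) monoid_scheme \<Rightarrow> bool" where
  "critical_type p k G \<longleftrightarrow>
     M_class (p ^ k) G \<and> k \<ge> 2 \<and> p_prime_core p G = {\<one>\<^bsub>G\<^esub>} \<and> card (frattini G) = p ^ (k - 1)"

definition semidirect_decomp :: "'a set \<Rightarrow> 'a set \<Rightarrow> ('a, 'b) monoid_scheme \<Rightarrow> bool" where
  "semidirect_decomp H P G \<longleftrightarrow>
     subgroup H G \<and> P \<lhd> G \<and> H <#>\<^bsub>G\<^esub> P = carrier G \<and> H \<inter> P = {\<one>\<^bsub>G\<^esub>}"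

text \<open>The quadruple \<open>(a, b, c, d)\<close> stands for the quaternion \<open>a + b i + c j + d k\<close>.\<close>

fun quat_mult :: "int \<times> int \<times> int \<times> int \<Rightarrow> int \<times> int \<times> int \<times> int \<Rightarrow> int \<times> int \<times> int \<times> int" where
  "quat_mult (a, b, c, d) (a', b', c', d') =
     (a * a' - b * b' - c * c' - d * d',
      a * b' + b * a' + c * d' - d * c',
      a * c' - b * d' + c * a' + d * b',
      a * d' + b * c' - c * b' + d * a')"

definition Q8 :: "(int \<times> int \<times> int \<times> int) monoid" where
  "Q8 = \<lparr>carrier = {(1, 0, 0, 0), (-1, 0, 0, 0), (0, 1, 0, 0), (0, -1, 0, 0),
                   (0, 0, 1, 0), (0, 0, -1, 0), (0, 0, 0, 1), (0, 0, 0, -1)},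
         monoid.mult = quat_mult, one = (1, 0, 0, 0)\<rparr>"

lemma group_Q8: "group Q8"
  by (rule groupI) (auto simp: Q8_def)

lemma order_Q8: "order Q8 = 8"
  by (simp add: order_def Q8_def)

end

theory Submission
  imports Defs "HOL-Number_Theory.Residue_Primitive_Roots"
begin

text \<open>Write \<open>\<Phi>\<close> for the Frattini subgroup; it is normal of order \<open>p ^ (k - 1)\<close>. Let \<open>x\<close> lie outside
  \<open>\<Phi>\<close> with \<open>x [^] p\<close> in \<open>\<Phi>\<close>. Then \<open>H = \<Phi> <#> \<langle>x\<rangle>\<close> has order \<open>p ^ k\<close>, so it has a supplement \<open>K\<close>. A maximal
  subgroup \<open>L\<close> of \<open>H\<close> other than \<open>\<Phi>\<close> would satisfy \<open>\<Phi> <#> L = H\<close>, hence \<open>\<Phi>\<close> and the proper subgroup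
  \<open>L <#> K\<close> would generate the group, which is impossible for the Frattini subgroup. So \<open>\<Phi>\<close> is the only maximal
  subgroup of \<open>H\<close>, and \<open>H = \<langle>x\<rangle>\<close> is cyclic (\<open>M_supplemented_over_frattini\<close>, \<open>root_of_Frat\<close>). In particular
  all elements of order \<open>p\<close> lie in the cyclic group \<open>\<Phi>\<close>. Moreover \<open>M = \<Phi> <#> K\<close> is a proper subgroup that
  contains \<open>\<Phi>\<close> but not \<open>x\<close>, and \<open>\<langle>x\<rangle> <#> M\<close> is the whole group.

  Let \<open>P\<close> be a Sylow \<open>p\<close>-subgroup. Each such \<open>M\<close> meets \<open>P\<close> in a normal subgroup of index \<open>p\<close>
  (\<open>maximal_trace\<close>), so no such \<open>x\<close> is a \<open>p\<close>-th power or a commutator in \<open>P\<close>. It follows that \<open>P / \<Phi>\<close> is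
  elementary abelian and that \<open>\<Phi>\<close> is central in \<open>P\<close>. If \<open>P\<close> is not cyclic, there are \<open>v\<close> and \<open>y\<close> in \<open>P\<close>, independent modulo
  \<open>\<Phi>\<close>, with \<open>v [^] p\<close> inverse to \<open>y [^] p\<close>. As \<open>P\<close> has class at most two, \<open>(v \<otimes> y) [^] p\<close> is the power
  of a commutator of order dividing \<open>p\<close> with exponent \<open>p choose 2\<close>; it is not trivial, and this forces \<open>p = 2\<close>, \<open>k = 2\<close>
  and \<open>v\<close>, \<open>y\<close> not to commute (\<open>noncyclic_sylow\<close>).

  What remains is to pass from \<open>P\<close> to the whole group. The tool is the transfer into an abelian
  \<open>p\<close>-subgroup \<open>P\<close> of index \<open>n\<close>: it sends a central element \<open>z\<close> of \<open>P\<close> to \<open>z [^] n\<close>. If \<open>n\<close> is prime to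
  \<open>p\<close> and the elements of order \<open>p\<close> in \<open>P\<close> are central, it is therefore injective on \<open>P\<close>, and its kernel is a
  normal complement of \<open>P\<close>. When there is no nontrivial normal subgroup of order prime to \<open>p\<close>, this yields
  equality of \<open>P\<close> with certain normal subgroups (\<open>normal_subgroup_eq_if_trivial_p_prime_core\<close>).
  If \<open>P\<close> is cyclic, the argument applies to the centralizer \<open>C\<close> of the subgroup \<open>Z\<close> of order \<open>p\<close> and gives
  \<open>C = P\<close>; so the quotient by \<open>P\<close> acts faithfully on \<open>Z\<close>, whose automorphism group is cyclic of order
  \<open>p - 1\<close>, and a suitable power of a generator of the quotient generates a complement. If \<open>P\<close> is
  not cyclic, it has order eight, and the argument applied to \<open>M\<close>, which has index two, gives \<open>M = P \<inter> M\<close>;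
  then the whole group has order eight and is the quaternion group.\<close>

section \<open>Subgroups of finite groups\<close>

context group
begin

lemma card_subgroup_dvd_card_subgroup:
  assumes "subgroup A G" and "subgroup B G" and "A \<subseteq> B"
  shows "card A dvd card B"
proof -
  interpret B: group "G\<lparr>carrier := B\<rparr>"
    using assms(2) by (rule subgroup_imp_group)
  show ?thesis
    using dvd_triv_right[of "card A"] unfolding B.lagrange[OF subgroup_incl[OF assms], symmetric, unfolded order_def, simplified] .
qed

lemma card_subgroup_dvd_order:
  assumes "subgroup A G"
  shows "card A dvd order G"
  using lagrange[OF assms] by (metis dvd_triv_right)

lemma subgroup_nat_pow_closed:
  assumes "subgroup H G" and "x \<in> H"
  shows "x [^] (i::nat) \<in> H"
  using assms by (induction i) (simp_all add: subgroup.one_closed subgroup.m_closed)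

lemma mult_inv_cancel_left:
  assumes "x \<in> carrier G" and "y \<in> carrier G"
  shows "x \<otimes> (inv x \<otimes> y) = y" and "inv x \<otimes> (x \<otimes> y) = y"
  using assms by (simp_all flip: m_assoc)

lemma set_mult_subset_subgroup:
  assumes "subgroup T G" and "A \<subseteq> T" and "B \<subseteq> T"
  shows "A <#> B \<subseteq> T"
proof -
  have "a \<otimes> b \<in> T" if "a \<in> A" "b \<in> B" for a b
    using that assms(2,3) by (intro subgroup.m_closed[OF assms(1)]) auto
  then show ?thesis by (auto simp: set_mult_def)
qed

lemma generate_single_subgroup:
  assumes "x \<in> carrier G"
  shows "subgroup (generate G {x}) G" and "x \<in> generate G {x}"
  using assms generate_is_subgroup[of "{x}"] generate.incl[of x "{x}" G] by auto

lemma generate_single_subset_iff: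
  assumes "subgroup H G" and "x \<in> carrier G"
  shows "generate G {x} \<subseteq> H \<longleftrightarrow> x \<in> H"
  using generate_subgroup_incl[of "{x}" H] generate_single_subgroup[OF assms(2)] assms by auto

lemma mem_generate_single_iff:
  assumes "finite (carrier G)" and "x \<in> carrier G"
  shows "y \<in> generate G {x} \<longleftrightarrow> (\<exists>i::nat. y = x [^] i)"
  using generate_pow_on_finite_carrier[OF assms] by auto

lemma nat_pow_commute:
  assumes "x \<in> carrier G" and "y \<in> carrier G" and "x \<otimes> y = y \<otimes> x"
  shows "x [^] (i::nat) \<otimes> y = y \<otimes> x [^] i"
proof (induction i)
  case (Suc i)
  then show ?case using assms m_assoc by (metis nat_pow_Suc nat_pow_closed)
qed (use assms in auto)

lemma generate_single_commute:
  assumes "finite (carrier G)" and x: "x \<in> carrier G"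
    and "a \<in> generate G {x}" and "b \<in> generate G {x}"
  shows "a \<otimes> b = b \<otimes> a"
proof -
  obtain i j :: nat where "a = x [^] i" "b = x [^] j"
    using assms by (auto simp: mem_generate_single_iff)
  then show ?thesis using x by (simp add: nat_pow_mult add.commute)
qed

section \<open>The Frattini subgroup and supplements\<close>

lemma proper_subgroup_in_maximal_subgroup:
  assumes fin: "finite (carrier G)" and "subgroup L G" and "L \<noteq> carrier G"
  obtains M where "maximal_subgroup M G" and "L \<subseteq> M"
proof -
  let ?S = "{M. subgroup M G \<and> M \<noteq> carrier G}"
  have "finite ?S"
    by (rule finite_subset[of _ "Pow (carrier G)"]) (use fin in \<open>auto dest: subgroup.subset\<close>)
  then obtain M where M: "M \<in> ?S" "L \<subseteq> M" and max: "\<forall>K\<in>?S. M \<subseteq> K \<longrightarrow> K = M"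
    using finite_has_maximal2[of ?S L] assms by auto
  have "maximal_subgroup M G"
    using M max unfolding maximal_subgroup_def by auto
  then show thesis using M that by blast
qed

text \<open>Conjugation is an automorphism, and an automorphism permutes the maximal subgroups.\<close>

lemma maximal_subgroup_conjugate:
  assumes M: "maximal_subgroup M G" and g: "g \<in> carrier G"
  shows "maximal_subgroup ((\<lambda>x. g \<otimes> x \<otimes> inv g) ` M) G"
proof -
  let ?c = "\<lambda>g x. g \<otimes> x \<otimes> inv g"
  have sub: "subgroup (?c h ` K) G" if "h \<in> carrier G" "subgroup K G" for h K
  proof (rule group_hom.subgroup_img_is_subgroup[of G])
    show "group_hom G G (?c h)"
      using that(1) by unfold_locales (auto simp: hom_def m_assoc mult_inv_cancel_left)
  qed (rule that(2))
  have inv: "?c (inv h) ` (?c h ` K) = K" if "h \<in> carrier G" "K \<subseteq> carrier G" for h K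
  proof -
    have "?c (inv h) (?c h x) = x" if "x \<in> K" for x
    proof -
      have "x \<in> carrier G" using that \<open>K \<subseteq> carrier G\<close> by blast
      then show ?thesis using \<open>h \<in> carrier G\<close> by (simp add: m_assoc mult_inv_cancel_left)
    qed
    then show ?thesis by (force simp: image_image)
  qed
  have inv': "?c h ` (?c (inv h) ` K) = K" if "h \<in> carrier G" "K \<subseteq> carrier G" for h K
    using inv[of "inv h" K] that by simp
  have carr: "?c h ` carrier G = carrier G" if h: "h \<in> carrier G" for h
  proof
    show "?c h ` carrier G \<subseteq> carrier G" using h by auto
    have "?c (inv h) ` carrier G \<subseteq> carrier G" using h by auto
    from image_mono[OF this, of "?c h"] show "carrier G \<subseteq> ?c h ` carrier G"
      unfolding inv'[OF h subset_refl] .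
  qed
  note M' = M[unfolded maximal_subgroup_def]
  have Msub: "subgroup M G" "M \<noteq> carrier G"
    using M' by simp_all
  have max: "K = carrier G" if "subgroup K G" "M \<subset> K" for K
    using M'[THEN conjunct2, THEN conjunct2] that by simp
  have MC: "M \<subseteq> carrier G" using Msub(1) by (rule subgroup.subset)
  show ?thesis
    unfolding maximal_subgroup_def
  proof (intro conjI allI impI)
    show "subgroup (?c g ` M) G" using sub g Msub by blast
    show "?c g ` M \<noteq> carrier G"
    proof
      assume "?c g ` M = carrier G"
      then have "M = ?c (inv g) ` carrier G" using inv[OF g MC] by (simp only:)
      then show False using carr[of "inv g"] g Msub(2) by (simp only: inv_closed)
    qed
  next
    fix K assume K: "subgroup K G \<and> ?c g ` M \<subset> K"
    then have KC: "K \<subseteq> carrier G" by (auto dest: subgroup.subset)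
    have "M \<subseteq> ?c (inv g) ` K"
      using image_mono[OF psubset_imp_subset[OF conjunct2[OF K]], of "?c (inv g)"]
      unfolding inv[OF g MC] .
    moreover have "M \<noteq> ?c (inv g) ` K"
    proof
      assume "M = ?c (inv g) ` K"
      then have "?c g ` M = K" using inv'[OF g KC] by (simp only:)
      then show False using K by simp
    qed
    moreover have "subgroup (?c (inv g) ` K) G"
      using sub[of "inv g" K] K g by simp
    ultimately have "?c (inv g) ` K = carrier G"
      by (intro max psubsetI)
    then have "K = ?c g ` carrier G" using inv'[OF g KC] by (simp only:)
    then show "K = carrier G" using carr[OF g] by (simp only:)
  qed
qed

lemma frattini_normal: "frattini G \<lhd> G"
proof (rule normal_invI)
  have eq: "frattini G = \<Inter> (insert (carrier G) {M. maximal_subgroup M G})"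
    by (auto simp: frattini_def)
  show "subgroup (frattini G) G"
    unfolding eq by (rule subgroups_Inter) (auto simp: maximal_subgroup_def subgroup_self)
next
  fix g x assume g: "g \<in> carrier G" and x: "x \<in> frattini G"
  have xC: "x \<in> carrier G" using x by (simp add: frattini_def)
  have "g \<otimes> x \<otimes> inv g \<in> M" if M: "maximal_subgroup M G" for M
  proof -
    have "x \<in> (\<lambda>x. inv g \<otimes> x \<otimes> inv (inv g)) ` M"
      using x maximal_subgroup_conjugate[OF M, of "inv g"] g by (auto simp: frattini_def)
    then obtain y where y: "y \<in> M" "x = inv g \<otimes> y \<otimes> g" using g by auto
    moreover have "y \<in> carrier G"
      using y M by (auto simp: maximal_subgroup_def dest: subgroup.subset)
    ultimately show ?thesis using g by (simp add: m_assoc mult_inv_cancel_left)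
  qed
  then show "g \<otimes> x \<otimes> inv g \<in> frattini G" using g xC by (auto simp: frattini_def)
qed

lemma proper_subgroup_frattini_bound:
  assumes "finite (carrier G)" and "subgroup L G" and "L \<noteq> carrier G"
  obtains T where "subgroup T G" and "T \<noteq> carrier G" and "L \<subseteq> T" and "frattini G \<subseteq> T"
proof -
  obtain M where M: "maximal_subgroup M G" "L \<subseteq> M"
    using proper_subgroup_in_maximal_subgroup[OF assms] .
  then show thesis
    using that[of M] by (auto simp: frattini_def maximal_subgroup_def)
qed

text \<open>The hypothesis on the order makes the Frattini subgroup \<open>F\<close> maximal in \<open>H\<close>. If \<open>x\<close> did
  not generate \<open>H\<close>, it would lie in a maximal subgroup \<open>L\<close> of \<open>H\<close> other than \<open>F\<close>, and then \<open>F <#> L = H\<close>.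
  A supplement \<open>K\<close> of \<open>H\<close> makes \<open>L <#> K\<close> proper, so some proper subgroup contains \<open>L\<close>, \<open>K\<close> and \<open>F\<close>, thus also \<open>H\<close>
  and \<open>K\<close>, which is absurd. The supplement condition for the maximal subgroup \<open>F\<close> itself provides
  the second conclusion, with \<open>M = F <#> K\<close>.\<close>

lemma M_supplemented_over_frattini:
  assumes fin: "finite (carrier G)" and H: "subgroup H G" and supp: "M_supplemented H G"
    and p: "Factorial_Ring.prime p"
    and FH: "frattini G \<subseteq> H" and cardH: "card H = p * card (frattini G)"
    and x: "x \<in> H" "x \<notin> frattini G"
  shows "generate G {x} = H"
    and "\<exists>M. subgroup M G \<and> frattini G \<subseteq> M \<and> x \<notin> M \<and> H <#> M = carrier G"
proof -
  let ?F = "frattini G"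
  have nF: "?F \<lhd> G" by (rule frattini_normal)
  have F: "subgroup ?F G" using nF by (rule normal_imp_subgroup)
  have HC: "H \<subseteq> carrier G" using H by (rule subgroup.subset)
  have finH: "finite H" using HC fin by (rule finite_subset)
  have xC: "x \<in> carrier G" using HC x by blast
  interpret GH: group "G\<lparr>carrier := H\<rparr>" using H by (rule subgroup_imp_group)
  have above: "L = H" if L: "subgroup L G" "?F \<subset> L" "L \<subseteq> H" for L
  proof -
    have finL: "finite L" using L finH finite_subset by blast
    obtain a where a: "card L = card ?F * a"
      using card_subgroup_dvd_card_subgroup[OF F L(1)] L by (auto elim: dvdE)
    have "card L dvd card H" using card_subgroup_dvd_card_subgroup[OF L(1) H L(3)] .
    moreover have "card ?F > 0" using F fin by (rule subgroup.finite_imp_card_positive)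
    ultimately have "a dvd p" using a cardH by (simp add: mult.commute)
    moreover have "a \<noteq> 1" using psubset_card_mono[OF finL L(2)] a by auto
    ultimately have "a = p" using p by (metis prime_nat_iff)
    then show "L = H" using a cardH L finH by (intro card_subset_eq) auto
  qed
  have maxF: "maximal_subgroup ?F (G\<lparr>carrier := H\<rparr>)"
    unfolding maximal_subgroup_def
  proof (intro conjI allI impI)
    show "subgroup ?F (G\<lparr>carrier := H\<rparr>)" using subgroup_incl[OF F H FH] .
    show "?F \<noteq> carrier (G\<lparr>carrier := H\<rparr>)" using x by auto
  next
    fix L assume L: "subgroup L (G\<lparr>carrier := H\<rparr>) \<and> ?F \<subset> L"
    then have "L \<subseteq> H" using subgroup.subset by fastforce
    then show "L = carrier (G\<lparr>carrier := H\<rparr>)"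
      using above[of L] incl_subgroup[OF H, of L] L by simp
  qed
  obtain K where K: "subgroup K G" and HK: "H <#> K = carrier G"
    and proper: "\<And>L. maximal_subgroup L (G\<lparr>carrier := H\<rparr>) \<Longrightarrow>
        subgroup (L <#> K) G \<and> L <#> K \<noteq> carrier G"
    using supp unfolding M_supplemented_def by blast
  have KC: "K \<subseteq> carrier G" using K by (rule subgroup.subset)
  show gen: "generate G {x} = H"
  proof (rule ccontr)
    assume ne: "generate G {x} \<noteq> H"
    have "generate G {x} \<subseteq> H"
      using generate_single_subset_iff[OF H xC] x by simp
    then have "subgroup (generate G {x}) (G\<lparr>carrier := H\<rparr>)"
      using generate_single_subgroup[OF xC] H by (intro subgroup_incl)
    then obtain L where L: "maximal_subgroup L (G\<lparr>carrier := H\<rparr>)" and xL: "x \<in> L"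
      using GH.proper_subgroup_in_maximal_subgroup[of "generate G {x}"] finH ne
        generate_single_subgroup(2)[OF xC] by auto
    have LsubH: "subgroup L (G\<lparr>carrier := H\<rparr>)" using L unfolding maximal_subgroup_def by blast
    have LG: "subgroup L G" using incl_subgroup[OF H LsubH] .
    have LH: "L \<subseteq> H" using subgroup.subset[OF LsubH] by simp
    let ?FL = "?F <#> L"
    have FL: "subgroup ?FL G" using mult_norm_subgroup[OF nF LG] .
    have FsubFL: "?F \<subseteq> ?FL" using subset_set_mult_right[OF subgroup.subset[OF F] LG] .
    have LsubFL: "L \<subseteq> ?FL" using subset_set_mult_left[OF subgroup.subset[OF LG] F] .
    have "?FL \<subseteq> H"
      using set_mult_subset_subgroup[OF H FH LH] .
    then have FLH: "?FL = H" using above[OF FL] FsubFL LsubFL xL x by blast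
    obtain T where T: "subgroup T G" "T \<noteq> carrier G" "L <#> K \<subseteq> T" "?F \<subseteq> T"
      using proper_subgroup_frattini_bound[OF fin] proper[OF L] by blast
    have "L \<subseteq> T" "K \<subseteq> T"
      using T subset_set_mult_right[OF subgroup.subset[OF LG] K] subset_set_mult_left[OF KC LG] by auto
    then have "H \<subseteq> T"
      using set_mult_subset_subgroup[OF T(1,4) \<open>L \<subseteq> T\<close>] FLH by simp
    then have "H <#> K \<subseteq> T"
      using set_mult_subset_subgroup[OF T(1)] \<open>K \<subseteq> T\<close> by simp
    then show False using HK T subgroup.subset by blast
  qed
  let ?M = "?F <#> K"
  have M: "subgroup ?M G" "?M \<noteq> carrier G" using proper[OF maxF] by auto
  have FM: "?F \<subseteq> ?M" using subset_set_mult_right[OF subgroup.subset[OF F] K] .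
  have KM: "K \<subseteq> ?M" using subset_set_mult_left[OF KC F] .
  have "x \<notin> ?M"
  proof
    assume "x \<in> ?M"
    then have "H \<subseteq> ?M" using gen generate_single_subset_iff[OF M(1) xC] by simp
    then have "H <#> K \<subseteq> ?M"
      using set_mult_subset_subgroup[OF M(1)] KM by simp
    then show False using HK M subgroup.subset by blast
  qed
  moreover have "H <#> ?M = carrier G"
    using HK mono_set_mult[OF subset_refl KM] setmult_subset_G[OF HC subgroup.subset[OF M(1)]]
    by blast
  ultimately show "\<exists>M. subgroup M G \<and> frattini G \<subseteq> M \<and> x \<notin> M \<and> H <#> M = carrier G"
    using M FM by blast
qed

section \<open>Transfer and normal complements\<close>

lemma pow_card_subgroup_eq_one:
  assumes "subgroup H G" and "x \<in> H"
  shows "x [^] card H = \<one>"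
proof -
  interpret H: group "G\<lparr>carrier := H\<rparr>"
    using assms(1) by (rule subgroup_imp_group)
  have "x [^]\<^bsub>G\<lparr>carrier := H\<rparr>\<^esub> order (G\<lparr>carrier := H\<rparr>) = \<one>\<^bsub>G\<lparr>carrier := H\<rparr>\<^esub>"
    using assms(2) by (intro H.pow_order_eq_1) simp
  then show ?thesis by (simp add: order_def nat_pow_consistent[symmetric])
qed

lemma eq_one_if_coprime_pows_eq_one:
  assumes x: "x \<in> carrier G" and "x [^] (m::nat) = \<one>" and "x [^] (n::nat) = \<one>" and "coprime m n"
  shows "x = \<one>"
proof -
  have "ord x dvd m" "ord x dvd n" using assms by (simp_all add: pow_eq_id)
  then have "ord x = 1" using assms(4) by (meson coprime_common_divisor_nat nat_dvd_1_iff_1 coprime_def)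
  then show ?thesis using x ord_eq_1 by blast
qed

text \<open>The transfer. For a choice \<open>t\<close> of representatives of the right cosets of \<open>P\<close>, it sends \<open>g\<close> to the
  product over all cosets \<open>c\<close> of the elements \<open>t c \<otimes> g \<otimes> inv t (c #> g)\<close> of \<open>P\<close>. It is
  multiplicative because \<open>g\<close> permutes the cosets and \<open>P\<close> is abelian. A central \<open>z\<close> in \<open>P\<close> fixes every coset,
  so each of its factors is \<open>z\<close>.\<close>

lemma transfer_exists:
  assumes fin: "finite (carrier G)" and P: "subgroup P G"
    and comm: "\<And>a b. a \<in> P \<Longrightarrow> b \<in> P \<Longrightarrow> a \<otimes> b = b \<otimes> a"
  obtains V where "V \<in> hom G (G\<lparr>carrier := P\<rparr>)"
    and "\<And>z. z \<in> P \<Longrightarrow> (\<And>g. g \<in> carrier G \<Longrightarrow> g \<otimes> z = z \<otimes> g) \<Longrightarrow> V z = z [^] card (rcosets P)"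
proof -
  let ?P = "G\<lparr>carrier := P\<rparr>"
  interpret P0: group ?P using P by (rule subgroup_imp_group)
  interpret A: comm_group ?P
    by (rule P0.group_comm_groupI) (simp add: comm)
  have PC: "P \<subseteq> carrier G" using P by (rule subgroup.subset)
  define t where "t c = (SOME g. g \<in> c)" for c :: "'a set"
  define W where "W g c = t c \<otimes> g \<otimes> inv t (c #> g)" for g c
  define V where "V g = finprod ?P (W g) (rcosets P)" for g
  have t: "t c \<in> c" "t c \<in> carrier G" "P #> t c = c" if c: "c \<in> rcosets P" for c
  proof -
    show m: "t c \<in> c"
      using subgroup.rcosets_non_empty[OF P c] unfolding t_def by (simp add: some_in_eq)
    obtain a where a: "a \<in> carrier G" "c = P #> a" using c by (auto simp: RCOSETS_def)
    show "t c \<in> carrier G" using m c subgroup.rcosets_carrier[OF P is_group] by blast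
    show "P #> t c = c" using repr_independence[of "t c" P a] m a P by simp
  qed
  have act: "c #> g \<in> rcosets P" if "c \<in> rcosets P" "g \<in> carrier G" for c g
    using that PC by (auto simp: RCOSETS_def coset_mult_assoc)
  have act_mult: "(c #> g) #> h = c #> (g \<otimes> h)"
    if "c \<in> rcosets P" "g \<in> carrier G" "h \<in> carrier G" for c g h
    using that subgroup.rcosets_carrier[OF P is_group] by (intro coset_mult_assoc) auto
  have act_one: "c #> \<one> = c" if "c \<in> rcosets P" for c
    using that subgroup.rcosets_carrier[OF P is_group] by (intro coset_mult_one) auto
  have bij: "inj_on (\<lambda>c. c #> g) (rcosets P)" "(\<lambda>c. c #> g) ` (rcosets P) = rcosets P"
    if g: "g \<in> carrier G" for g
  proof -
    have "(c #> g) #> inv g = c" "(c #> inv g) #> g = c" if "c \<in> rcosets P" for c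
      using that g by (simp_all add: act_mult act_one)
    then have "bij_betw (\<lambda>c. c #> g) (rcosets P) (rcosets P)"
      using act g by (intro bij_betw_byWitness[of _ "\<lambda>c. c #> inv g"]) auto
    then show "inj_on (\<lambda>c. c #> g) (rcosets P)" "(\<lambda>c. c #> g) ` (rcosets P) = rcosets P"
      by (simp_all add: bij_betw_def)
  qed
  have WP: "W g c \<in> P" if c: "c \<in> rcosets P" and g: "g \<in> carrier G" for g c
  proof -
    have "c #> g = P #> (t c \<otimes> g)"
      using coset_mult_assoc[OF PC t(2)[OF c] g] t(3)[OF c] by simp
    then have "t c \<otimes> g \<in> c #> g"
      using rcos_self[OF _ P, of "t c \<otimes> g"] t(2)[OF c] g by simp
    then show ?thesis
      unfolding W_def using diff_neutralizes[OF P act[OF c g]] t(1)[OF act[OF c g]] by blast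
  qed
  have VP: "V g \<in> P" if g: "g \<in> carrier G" for g
  proof -
    have "finprod ?P (W g) (rcosets P) \<in> carrier ?P"
      using WP g by (intro A.finprod_closed) auto
    then show ?thesis by (simp add: V_def)
  qed
  have W_mult: "W (g \<otimes> h) c = W g c \<otimes> W h (c #> g)"
    if c: "c \<in> rcosets P" and g: "g \<in> carrier G" and h: "h \<in> carrier G" for g h c
  proof -
    have cancel: "a \<otimes> (g \<otimes> h) \<otimes> inv d = (a \<otimes> g \<otimes> inv b) \<otimes> (b \<otimes> h \<otimes> inv d)"
      if "a \<in> carrier G" "b \<in> carrier G" "d \<in> carrier G" for a b d
      using that g h by (simp add: m_assoc mult_inv_cancel_left)
    show ?thesis
      unfolding W_def act_mult[OF c g h]
      by (rule cancel[OF t(2)[OF c] t(2)[OF act[OF c g]] t(2)[OF act[OF c m_closed[OF g h]]]])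
  qed
  have V_mult: "V (g \<otimes> h) = V g \<otimes> V h" if g: "g \<in> carrier G" and h: "h \<in> carrier G" for g h
  proof -
    have "V (g \<otimes> h) = finprod ?P (\<lambda>c. W g c \<otimes>\<^bsub>?P\<^esub> W h (c #> g)) (rcosets P)"
      unfolding V_def
    proof (rule A.finprod_cong'[OF refl])
      show "(\<lambda>c. W g c \<otimes>\<^bsub>?P\<^esub> W h (c #> g)) \<in> rcosets P \<rightarrow> carrier ?P"
        using WP[OF _ g] WP[OF act[OF _ g] h] subgroup.m_closed[OF P] by simp
    qed (simp add: W_mult[OF _ g h])
    also have "\<dots> = V g \<otimes>\<^bsub>?P\<^esub> finprod ?P (\<lambda>c. W h (c #> g)) (rcosets P)"
      unfolding V_def
      by (rule A.finprod_multf) (simp_all add: WP[OF _ g] WP[OF act[OF _ g] h])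
    also have "finprod ?P (\<lambda>c. W h (c #> g)) (rcosets P) = finprod ?P (W h) ((\<lambda>c. c #> g) ` (rcosets P))"
      by (rule A.finprod_reindex[symmetric]) (simp_all add: WP[OF _ h] bij[OF g])
    also have "\<dots> = V h" unfolding V_def bij(2)[OF g] ..
    finally show ?thesis by simp
  qed
  have "V \<in> hom G ?P" using VP V_mult by (auto simp: hom_def)
  moreover have "V z = z [^] card (rcosets P)"
    if z: "z \<in> P" and central: "\<And>g. g \<in> carrier G \<Longrightarrow> g \<otimes> z = z \<otimes> g" for z
  proof -
    have zC: "z \<in> carrier G" using z PC by blast
    have "W z c = z" if c: "c \<in> rcosets P" for c
    proof -
      have "c #> z = P #> (t c \<otimes> z)"
        using coset_mult_assoc[OF PC t(2)[OF c] zC] t(3)[OF c] by simp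
      also have "\<dots> = (P #> z) #> t c"
        using coset_mult_assoc[OF PC zC t(2)[OF c]] central[OF t(2)[OF c]] by simp
      also have "\<dots> = c" using coset_join2[OF zC P z] t(3)[OF c] by simp
      finally have "c #> z = c" .
      then show ?thesis
        unfolding W_def using central[OF t(2)[OF c]] t(2)[OF c] zC by (simp add: m_assoc)
    qed
    then have "V z = finprod ?P (\<lambda>c. z) (rcosets P)"
      unfolding V_def using z by (intro A.finprod_cong') auto
    also have "\<dots> = z [^] card (rcosets P)"
      using A.finprod_const[of z "rcosets P"] z by (simp add: nat_pow_consistent[symmetric])
    finally show ?thesis .
  qed
  ultimately show thesis using that by blast
qed

text \<open>The complement is the kernel of the transfer \<open>V\<close> into \<open>P\<close>. Any nontrivial subgroup of the \<open>p\<close>-group \<open>P\<close>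
  contains an element \<open>v\<close> of order \<open>p\<close>; it is central, so \<open>V\<close> sends it to a power of \<open>v\<close> with exponent
  prime to \<open>p\<close>, which is not trivial. Hence \<open>V\<close> is injective on \<open>P\<close>, so it maps onto \<open>P\<close> and its kernel has the
  order of the index of \<open>P\<close>. Describing the kernel by an equation shows that it is
  invariant under all automorphisms.\<close>

lemma normal_complement_if_central_torsion:
  assumes fin: "finite (carrier G)" and P: "subgroup P G"
    and comm: "\<And>a b. a \<in> P \<Longrightarrow> b \<in> P \<Longrightarrow> a \<otimes> b = b \<otimes> a"
    and p: "Factorial_Ring.prime p" and cardP: "card P = p ^ a" and cop: "coprime (card (rcosets P)) p"
    and central: "\<And>z g. z \<in> P \<Longrightarrow> z [^] p = \<one> \<Longrightarrow> g \<in> carrier G \<Longrightarrow> g \<otimes> z = z \<otimes> g"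
  shows "subgroup {g \<in> carrier G. g [^] card (rcosets P) = \<one>} G"
    and "card {g \<in> carrier G. g [^] card (rcosets P) = \<one>} = card (rcosets P)"
proof -
  let ?P = "G\<lparr>carrier := P\<rparr>" and ?n = "card (rcosets P)"
  interpret P0: group ?P using P by (rule subgroup_imp_group)
  have PC: "P \<subseteq> carrier G" using P by (rule subgroup.subset)
  obtain V where V: "V \<in> hom G ?P"
    and Vz: "\<And>z. z \<in> P \<Longrightarrow> (\<And>g. g \<in> carrier G \<Longrightarrow> g \<otimes> z = z \<otimes> g) \<Longrightarrow> V z = z [^] ?n"
    using transfer_exists[OF fin P comm] by metis
  interpret V: group_hom G ?P V using V by unfold_locales
  have VP: "V g \<in> P" if "g \<in> carrier G" for g using V.hom_closed[OF that] by simp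
  have V_pow: "V (g [^] (i::nat)) = V g [^] i" if "g \<in> carrier G" for g i
    using V.hom_nat_pow[OF that, of i] by (simp add: nat_pow_consistent[symmetric])
  have ker: "u = \<one>" if u: "u \<in> P" "V u = \<one>" for u
  proof (rule ccontr)
    assume "u \<noteq> \<one>"
    have uC: "u \<in> carrier G" using u PC by blast
    have "ord u dvd p ^ a"
      using pow_card_subgroup_eq_one[OF P u(1)] cardP uC by (simp add: pow_eq_id)
    then obtain j where j: "ord u = p ^ j" using divides_primepow_nat[OF p] by blast
    have "j \<noteq> 0" using \<open>u \<noteq> \<one>\<close> j ord_eq_1[OF uC] by (cases j) auto
    then obtain i where i: "j = Suc i" by (cases j) auto
    \<comment> \<open>The power of \<open>u\<close> of order \<open>p\<close>.\<close>
    let ?v = "u [^] (p ^ i)"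
    have vP: "?v \<in> P" using subgroup_nat_pow_closed[OF P u(1)] .
    have vp: "?v [^] p = \<one>"
      using pow_ord_eq_1[OF uC] uC by (simp add: nat_pow_pow j i mult.commute)
    have "V ?v = ?v [^] ?n" using Vz[OF vP] central[OF vP vp] by blast
    moreover have "V ?v = \<one>" using V_pow[OF uC] u by simp
    ultimately have "?v = \<one>"
      using eq_one_if_coprime_pows_eq_one[of ?v ?n p] cop vp uC by simp
    then have "p ^ Suc i dvd p ^ i" using uC by (simp add: pow_eq_id j i)
    then show False using p by (metis dvd_power_iff_le lessI not_less prime_ge_2_nat)
  qed
  have "inj_on V P"
  proof (rule inj_onI)
    fix u w assume uw: "u \<in> P" "w \<in> P" "V u = V w"
    have C: "u \<in> carrier G" "w \<in> carrier G" using uw PC by auto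
    have "V (u \<otimes> inv w) = V u \<otimes> inv V w"
      using C V.hom_mult[of u "inv w"] V.hom_inv[of w] m_inv_consistent[OF P VP] by simp
    also have "\<dots> = \<one>" using uw VP[OF C(2)] PC by auto
    finally have "u \<otimes> inv w = \<one>"
      using ker uw subgroup.m_closed[OF P] subgroup.m_inv_closed[OF P] by blast
    then show "u = w" using C by (metis inv_equality inv_inv inv_closed)
  qed
  moreover have "V ` P \<subseteq> P" using VP PC by blast
  ultimately have "V ` P = P"
    using fin PC by (intro endo_inj_surj) (auto intro: finite_subset)
  then have "P \<subseteq> V ` carrier G" using PC by blast
  then have surj: "V ` carrier G = carrier ?P" using VP by auto
  let ?K = "kernel G ?P V"
  have K: "subgroup ?K G" by (rule V.subgroup_kernel)
  have "(G Mod ?K) \<cong> ?P" using V.FactGroup_iso[OF surj] .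
  then have "card (carrier (G Mod ?K)) = card P" using iso_same_card by fastforce
  then have "card (rcosets ?K) = card P" by (simp add: FactGroup_def)
  then have "card P * card ?K = card P * ?n"
    using lagrange[OF K] lagrange[OF P] by (simp add: mult.commute)
  moreover have "card P \<noteq> 0" using p cardP by simp
  ultimately have cardK: "card ?K = ?n" by simp
  have "?K = {g \<in> carrier G. g [^] ?n = \<one>}"
  proof (intro equalityI subsetI)
    fix g assume "g \<in> ?K"
    then show "g \<in> {g \<in> carrier G. g [^] ?n = \<one>}"
      using pow_card_subgroup_eq_one[OF K] subgroup.subset[OF K] cardK by auto
  next
    fix g assume "g \<in> {g \<in> carrier G. g [^] ?n = \<one>}"
    then have g: "g \<in> carrier G" "g [^] ?n = \<one>" by auto
    have "V g [^] ?n = \<one>" using V_pow[OF g(1), of ?n] g(2) V.hom_one by simp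
    moreover have "V g [^] (p ^ a) = \<one>"
      using pow_card_subgroup_eq_one[OF P VP[OF g(1)]] cardP by simp
    moreover have "coprime ?n (p ^ a)" using cop by simp
    ultimately have "V g = \<one>"
      using eq_one_if_coprime_pows_eq_one[OF subsetD[OF PC VP[OF g(1)]]] by blast
    then show "g \<in> ?K" using g by (simp add: kernel_def)
  qed
  then show "subgroup {g \<in> carrier G. g [^] ?n = \<one>} G"
    and "card {g \<in> carrier G. g [^] ?n = \<one>} = ?n"
    using K cardK by simp_all
qed

text \<open>The normal complement of \<open>P\<close> in \<open>C\<close> consists of all solutions of \<open>g [^] n = \<one>\<close> in \<open>C\<close>, so it is
  normal in the whole group; its order is prime to \<open>p\<close>, so it is trivial.\<close>

lemma normal_subgroup_eq_if_trivial_p_prime_core: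
  assumes fin: "finite (carrier G)" and core: "p_prime_core p G = {\<one>}"
    and p: "Factorial_Ring.prime p" and C: "C \<lhd> G" and P: "subgroup P G" and PC: "P \<subseteq> C"
    and comm: "\<And>a b. a \<in> P \<Longrightarrow> b \<in> P \<Longrightarrow> a \<otimes> b = b \<otimes> a"
    and cardP: "card P = p ^ a" and cardC: "card C = card P * n" and cop: "coprime n p"
    and central: "\<And>z g. z \<in> P \<Longrightarrow> z [^] p = \<one> \<Longrightarrow> g \<in> C \<Longrightarrow> g \<otimes> z = z \<otimes> g"
  shows "C = P"
proof -
  let ?C = "G\<lparr>carrier := C\<rparr>" and ?N = "{g \<in> C. g [^] n = \<one>}"
  have CG: "subgroup C G" using C by (rule normal_imp_subgroup)
  interpret C0: group ?C using CG by (rule subgroup_imp_group)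
  have CC: "C \<subseteq> carrier G" using CG by (rule subgroup.subset)
  have PsubC: "subgroup P ?C" using subgroup_incl[OF P CG PC] .
  have "card (rcosets\<^bsub>?C\<^esub> P) * card P = card P * n"
    using C0.lagrange[OF PsubC] cardC by (simp add: order_def)
  then have n: "card (rcosets\<^bsub>?C\<^esub> P) = n" using p cardP by simp
  have finC: "finite (carrier ?C)" using fin CC finite_subset by auto
  have "subgroup ?N ?C" and cardN: "card ?N = n"
    using C0.normal_complement_if_central_torsion[OF finC PsubC _ p cardP] comm cop central
    by (simp_all add: n nat_pow_consistent[symmetric])
  then have NG: "subgroup ?N G" using incl_subgroup[OF CG] by blast
  have "?N \<lhd> G"
  proof (rule normal_invI[OF NG])
    fix g x assume g: "g \<in> carrier G" and x: "x \<in> ?N"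
    have xC: "x \<in> carrier G" using x CC by auto
    have "(g \<otimes> x \<otimes> inv g) [^] i = g \<otimes> x [^] i \<otimes> inv g" for i :: nat
      using g xC by (induction i) (simp_all add: m_assoc mult_inv_cancel_left)
    then show "g \<otimes> x \<otimes> inv g \<in> ?N"
      using x g normal.inv_op_closed2[OF C g] by auto
  qed
  then have "?N \<subseteq> {\<one>}"
    using p_prime_core_greatest(3)[OF fin, of ?N p] core cardN cop by simp
  then have "card ?N \<le> 1" using card_mono[of "{\<one>}" ?N] by simp
  then have "card C \<le> card P" using cardN cardC by (cases n) auto
  then show ?thesis using card_seteq[of C P] finC PC by simp
qed

section \<open>Subgroups of prime index in a group of prime power order\<close>

text \<open>Let \<open>g\<close> not normalize \<open>Q\<close>. The cosets of \<open>Q\<close> inside the double coset of \<open>g\<close> correspond to the cosets in \<open>Q\<close> of the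
  subgroup \<open>S\<close> of all \<open>q\<close> whose conjugate by \<open>g\<close> stays in \<open>Q\<close>. There are at least \<open>p\<close> of these, since \<open>S\<close> is a
  proper subgroup of a \<open>p\<close>-group, but at most \<open>p - 1\<close> cosets of \<open>Q\<close> differ from \<open>Q\<close>.\<close>

lemma prime_index_subgroup_normal:
  assumes fin: "finite (carrier G)" and p: "Factorial_Ring.prime p" and ord: "order G = p ^ a"
    and Q: "subgroup Q G" and idx: "order G = p * card Q"
  shows "Q \<lhd> G"
proof (rule normal_invI[OF Q])
  fix g q0 assume g: "g \<in> carrier G" and q0: "q0 \<in> Q"
  show "g \<otimes> q0 \<otimes> inv g \<in> Q"
  proof (rule ccontr)
    assume contra: "g \<otimes> q0 \<otimes> inv g \<notin> Q"
    have QC: "Q \<subseteq> carrier G" using Q by (rule subgroup.subset)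
    have finQ: "finite Q" using QC fin finite_subset by blast
    define S where "S = {q \<in> Q. g \<otimes> q \<otimes> inv g \<in> Q}"
    have S: "subgroup S G"
    proof (rule subgroupI)
      show "S \<subseteq> carrier G" using QC by (auto simp: S_def)
      have "\<one> \<in> S" using g subgroup.one_closed[OF Q] by (simp add: S_def)
      then show "S \<noteq> {}" by blast
    next
      fix x assume x: "x \<in> S"
      then have x': "x \<in> Q" "g \<otimes> x \<otimes> inv g \<in> Q" by (auto simp: S_def)
      then have "inv (g \<otimes> x \<otimes> inv g) \<in> Q" "inv x \<in> Q" "x \<in> carrier G"
        using QC subgroup.m_inv_closed[OF Q] by blast+
      then show "inv x \<in> S" using g by (simp add: S_def inv_mult_group m_assoc)
    next
      fix x y assume xy: "x \<in> S" "y \<in> S"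
      then have xy': "x \<in> Q" "y \<in> Q" "g \<otimes> x \<otimes> inv g \<in> Q" "g \<otimes> y \<otimes> inv g \<in> Q"
        by (auto simp: S_def)
      then have "(g \<otimes> x \<otimes> inv g) \<otimes> (g \<otimes> y \<otimes> inv g) \<in> Q" "x \<otimes> y \<in> Q"
        "x \<in> carrier G" "y \<in> carrier G"
        using QC subgroup.m_closed[OF Q] by blast+
      then show "x \<otimes> y \<in> S" using g by (simp add: S_def m_assoc mult_inv_cancel_left)
    qed
    have SQ: "S \<subset> Q" using contra q0 by (auto simp: S_def)
    obtain b where b: "card Q = card S * b"
      using card_subgroup_dvd_card_subgroup[OF S Q] SQ by (auto elim: dvdE)
    \<comment> \<open>The index \<open>b\<close> of \<open>S\<close> in \<open>Q\<close> is a power of \<open>p\<close> other than one.\<close>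
    have "b \<noteq> 1" using psubset_card_mono[OF finQ SQ] b by auto
    moreover have "b dvd p ^ a" using b idx ord by (metis dvd_triv_right dvd_mult)
    ultimately have "p dvd b"
      using divides_primepow_nat[OF p, of b a] by (metis dvd_power le_zero_eq neq0_conv power_0)
    moreover have "card Q > 0" using Q fin by (rule subgroup.finite_imp_card_positive)
    ultimately have big: "p * card S \<le> card Q" using b by (auto simp: dvd_imp_le)
    have cS: "card S > 0" using S fin by (rule subgroup.finite_imp_card_positive)
    let ?f = "\<lambda>q. Q #> (g \<otimes> q)"
    have gQ: "g \<notin> Q"
      using contra q0 subgroup.m_closed[OF Q] subgroup.m_inv_closed[OF Q] by blast
    have img: "?f ` Q \<subseteq> rcosets Q - {Q}"
    proof -
      have "Q #> (g \<otimes> q) \<noteq> Q" if q: "q \<in> Q" for q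
      proof
        have qC: "q \<in> carrier G" using q QC by blast
        assume "Q #> (g \<otimes> q) = Q"
        then have "g \<otimes> q \<in> Q" using coset_join1[of Q "g \<otimes> q"] g qC Q QC by simp
        then have "g \<otimes> q \<otimes> inv q \<in> Q"
          using q subgroup.m_closed[OF Q] subgroup.m_inv_closed[OF Q] by blast
        then show False using gQ g qC by (simp add: m_assoc)
      qed
      then show ?thesis using g QC by (auto intro!: rcosetsI)
    qed
    have fin_rc: "finite (rcosets Q)"
      using fin rcosets_subset_PowG[OF Q] finite_subset by blast
    have "card (rcosets Q) = p"
      using lagrange[OF Q] idx \<open>card Q > 0\<close> by simp
    moreover have "Q \<in> rcosets Q" using subgroup.subgroup_in_rcosets[OF Q is_group] .
    ultimately have "card (rcosets Q - {Q}) = p - 1" using fin_rc by simp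
    then have card_img: "card (?f ` Q) \<le> p - 1"
      using card_mono[OF _ img] fin_rc by simp
    \<comment> \<open>Elements of \<open>Q\<close> with the same coset lie in one coset of \<open>S\<close>.\<close>
    have fibre: "card {q \<in> Q. ?f q = c} \<le> card S" if "c \<in> ?f ` Q" for c
    proof -
      obtain r where r: "r \<in> Q" "c = ?f r" using \<open>c \<in> ?f ` Q\<close> by blast
      have rC: "r \<in> carrier G" using r QC by blast
      have "q \<otimes> inv r \<in> S" if q: "q \<in> Q" "?f q = ?f r" for q
      proof -
        have qC: "q \<in> carrier G" using q QC by blast
        have "g \<otimes> q \<in> Q #> (g \<otimes> r)"
          using repr_independenceD[OF Q, of "g \<otimes> q" "g \<otimes> r"] q(2) g qC by simp
        then have "g \<otimes> q \<otimes> inv (g \<otimes> r) \<in> Q"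
          using subgroup.rcos_module_imp[OF Q is_group, of "g \<otimes> r"] g rC by simp
        then show ?thesis
          using q r g qC rC subgroup.m_closed[OF Q] subgroup.m_inv_closed[OF Q]
          by (simp add: S_def inv_mult_group m_assoc)
      qed
      then have "(\<lambda>q. q \<otimes> inv r) ` {q \<in> Q. ?f q = c} \<subseteq> S" using r by auto
      moreover have "inj_on (\<lambda>q. q \<otimes> inv r) {q \<in> Q. ?f q = c}"
        using QC rC by (auto simp: inj_on_def subset_iff)
      moreover have "finite S" using SQ finQ finite_subset by blast
      ultimately show ?thesis using card_inj_on_le by blast
    qed
    have "card Q = (\<Sum>c\<in>?f ` Q. card {q \<in> Q. ?f q = c})"
      using sum.image_gen[OF finQ, of "\<lambda>_. 1::nat" ?f] by simp
    also have "\<dots> \<le> (\<Sum>c\<in>?f ` Q. card S)" by (rule sum_mono) (rule fibre)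
    also have "\<dots> \<le> (p - 1) * card S" using card_img by simp
    also have "\<dots> < p * card S" using cS prime_gt_0_nat[OF p] by simp
    finally show False using big by simp
  qed
qed

section \<open>Groups acting on a subgroup of prime order\<close>

lemma nat_pow_mod:
  assumes x: "x \<in> carrier G" and "x [^] (n::nat) = \<one>"
  shows "x [^] (i mod n) = x [^] i"
proof -
  have "x [^] i = x [^] (n * (i div n) + i mod n)" by simp
  also have "\<dots> = (x [^] n) [^] (i div n) \<otimes> x [^] (i mod n)"
    using x by (simp only: nat_pow_mult[symmetric] nat_pow_pow)
  finally show ?thesis using assms by simp
qed

lemma nat_pow_eq_imp_mod_eq:
  assumes fin: "finite (carrier G)" and x: "x \<in> carrier G" and eq: "x [^] i = x [^] (j::nat)"
  shows "i mod ord x = j mod ord x"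
proof -
  have pos: "ord x > 0" using ord_ge_1[OF fin x] by simp
  have "x [^] (i mod ord x) = x [^] (j mod ord x)"
    using eq nat_pow_mod[OF x pow_ord_eq_1[OF x]] by simp
  moreover have "i mod ord x \<in> {0..ord x - 1}" "j mod ord x \<in> {0..ord x - 1}"
    using mod_less_divisor[OF pos, of i] mod_less_divisor[OF pos, of j]
    by (simp_all only: atLeastAtMost_iff) linarith+
  ultimately show ?thesis by (rule inj_onD[OF ord_inj[OF x]])
qed

lemma centralizer_normal:
  assumes Z: "Z \<subseteq> carrier G" and conj: "\<And>g z. g \<in> carrier G \<Longrightarrow> z \<in> Z \<Longrightarrow> g \<otimes> z \<otimes> inv g \<in> Z"
  shows "centralizer G Z \<lhd> G"
proof (rule normal_invI)
  show "subgroup (centralizer G Z) G"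
  proof (rule subgroupI)
    show "centralizer G Z \<subseteq> carrier G" by (auto simp: centralizer_def)
    have "\<one> \<in> centralizer G Z" using Z by (auto simp: centralizer_def)
    then show "centralizer G Z \<noteq> {}" by blast
  next
    fix c assume c: "c \<in> centralizer G Z"
    then have cC: "c \<in> carrier G" by (simp add: centralizer_def)
    have "inv c \<otimes> z = z \<otimes> inv c" if z: "z \<in> Z" for z
    proof -
      have zC: "z \<in> carrier G" using z Z by blast
      have "c \<otimes> z = z \<otimes> c" using c z by (simp add: centralizer_def)
      then have "inv c \<otimes> (c \<otimes> z) \<otimes> inv c = inv c \<otimes> (z \<otimes> c) \<otimes> inv c" by simp
      then show ?thesis using cC zC by (simp add: m_assoc mult_inv_cancel_left)
    qed
    then show "inv c \<in> centralizer G Z" using cC by (simp add: centralizer_def)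
  next
    fix c d assume cd: "c \<in> centralizer G Z" "d \<in> centralizer G Z"
    then have C: "c \<in> carrier G" "d \<in> carrier G" by (simp_all add: centralizer_def)
    have "c \<otimes> d \<otimes> z = z \<otimes> (c \<otimes> d)" if z: "z \<in> Z" for z
    proof -
      have zC: "z \<in> carrier G" using z Z by blast
      have cz: "c \<otimes> z = z \<otimes> c" and dz: "d \<otimes> z = z \<otimes> d"
        using cd z by (simp_all add: centralizer_def)
      have "c \<otimes> d \<otimes> z = c \<otimes> z \<otimes> d" using C zC dz by (simp add: m_assoc)
      then show ?thesis unfolding cz using C zC by (simp add: m_assoc)
    qed
    then show "c \<otimes> d \<in> centralizer G Z" using C by (simp add: centralizer_def)
  qed
next
  fix g c assume g: "g \<in> carrier G" and c: "c \<in> centralizer G Z"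
  have cC: "c \<in> carrier G" using c by (simp add: centralizer_def)
  have "g \<otimes> c \<otimes> inv g \<otimes> z = z \<otimes> (g \<otimes> c \<otimes> inv g)" if z: "z \<in> Z" for z
  proof -
    have zC: "z \<in> carrier G" using z Z by blast
    have w: "inv g \<otimes> z \<otimes> g \<in> Z" using conj[of "inv g" z] g z by simp
    have cw: "c \<otimes> (inv g \<otimes> z \<otimes> g) = (inv g \<otimes> z \<otimes> g) \<otimes> c"
      using c w by (simp add: centralizer_def)
    have "g \<otimes> c \<otimes> inv g \<otimes> z = g \<otimes> (c \<otimes> (inv g \<otimes> z \<otimes> g)) \<otimes> inv g"
      using g cC zC by (simp add: m_assoc)
    also have "\<dots> = z \<otimes> (g \<otimes> c \<otimes> inv g)"
      unfolding cw using g cC zC by (simp add: m_assoc mult_inv_cancel_left)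
    finally show ?thesis .
  qed
  then show "g \<otimes> c \<otimes> inv g \<in> centralizer G Z" using g cC by (simp add: centralizer_def)
qed

lemma conjugate_nat_pow:
  assumes "g \<in> carrier G" and "x \<in> carrier G"
  shows "(g \<otimes> x \<otimes> inv g) [^] (i::nat) = g \<otimes> x [^] i \<otimes> inv g"
  using assms by (induction i) (simp_all add: m_assoc mult_inv_cancel_left)

text \<open>The automorphisms of a group of prime order \<open>p\<close> are the power maps with exponent prime to \<open>p\<close>. For a primitive root \<open>r\<close>
  modulo \<open>p\<close>, the value of the homomorphism at \<open>g\<close> is the discrete logarithm \<open>i\<close> of the action of \<open>g\<close>, determined by
  \<open>g \<otimes> z \<otimes> inv g = z [^] (r ^ i)\<close>.\<close>

lemma hom_of_action_on_prime_order_subgroup: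
  assumes fin: "finite (carrier G)" and p: "Factorial_Ring.prime p"
    and z: "z \<in> carrier G" and ordz: "ord z = p"
    and conj: "\<And>g. g \<in> carrier G \<Longrightarrow> g \<otimes> z \<otimes> inv g \<in> generate G {z}"
  obtains \<alpha> where "\<alpha> \<in> hom G (integer_mod_group (p - 1))"
    and "\<And>g. g \<in> carrier G \<Longrightarrow> \<alpha> g = 0 \<longleftrightarrow> g \<otimes> z = z \<otimes> g"
proof -
  have p1: "p > 1" using p by (rule prime_gt_1_nat)
  obtain r where r: "residue_primroot p r" using prime_primitive_root_exists p1 p
    by (metis One_nat_def Suc_leI gr_implies_not0 neq0_conv)
  have "totient p = p - 1" using p by (rule totient_prime)
  then have bij: "bij_betw (\<lambda>i. r ^ i mod p) {..<p - 1} (totatives p)"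
    using residue_primroot_is_generator[OF p1 r] by simp
  \<comment> \<open>Exponents of \<open>r\<close> may be reduced modulo \<open>p - 1\<close>, so the discrete logarithm is additive.\<close>
  have r_pow: "r ^ (p - 1) mod p = 1"
  proof -
    have "coprime r p" using r by (simp add: residue_primroot_def coprime_commute)
    then have "[r ^ totient p = 1] (mod p)" by (rule euler_theorem)
    then show ?thesis using \<open>totient p = p - 1\<close> p1 by (simp add: cong_def)
  qed
  have zp: "z [^] p = \<one>" using pow_ord_eq_1[OF z] ordz by simp
  have ex: "\<exists>!i. i < p - 1 \<and> g \<otimes> z \<otimes> inv g = z [^] (r ^ i)" if g: "g \<in> carrier G" for g
  proof -
    obtain j :: nat where j: "g \<otimes> z \<otimes> inv g = z [^] j"
      using conj[OF g] mem_generate_single_iff[OF fin z] by blast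
    have "j mod p \<noteq> 0"
    proof
      assume "j mod p = 0"
      then have "z [^] j = \<one>" using nat_pow_mod[OF z zp, of j] by simp
      then have "inv g \<otimes> (g \<otimes> z \<otimes> inv g) \<otimes> g = \<one>" using j g by simp
      then have "z = \<one>" using g z by (simp add: m_assoc mult_inv_cancel_left)
      then show False using ordz p1 by simp
    qed
    then have "j mod p \<in> totatives p"
      using p p1 by (simp add: totatives_prime)
    then have "j mod p \<in> (\<lambda>i. r ^ i mod p) ` {..<p - 1}"
      using bij by (simp only: bij_betw_def)
    then obtain i where "j mod p = r ^ i mod p" "i \<in> {..<p - 1}" by (rule imageE)
    then have i: "i < p - 1" "r ^ i mod p = j mod p" by (simp_all only: lessThan_iff)
    have "z [^] j = z [^] (r ^ i mod p)"
      unfolding i(2) by (rule nat_pow_mod[OF z zp, symmetric])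
    then have eq: "g \<otimes> z \<otimes> inv g = z [^] (r ^ i)"
      unfolding j by (rule trans[OF _ nat_pow_mod[OF z zp]])
    have "i' = i" if i': "i' < p - 1" "g \<otimes> z \<otimes> inv g = z [^] (r ^ i')" for i'
    proof -
      have "z [^] (r ^ i') = z [^] (r ^ i)" using i'(2) eq by simp
      then have "r ^ i' mod p = r ^ i mod p"
        using nat_pow_eq_imp_mod_eq[OF fin z] ordz by blast
      then show ?thesis using bij i(1) i'(1) by (auto simp: bij_betw_def inj_on_def)
    qed
    then show ?thesis using i(1) eq by blast
  qed
  define e where "e g = (THE i. i < p - 1 \<and> g \<otimes> z \<otimes> inv g = z [^] (r ^ i))" for g
  have e: "e g < p - 1" "g \<otimes> z \<otimes> inv g = z [^] (r ^ e g)" if "g \<in> carrier G" for g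
    using theI'[OF ex[OF that]] unfolding e_def by simp_all
  have e_unique: "e g = i" if "g \<in> carrier G" "i < p - 1" "g \<otimes> z \<otimes> inv g = z [^] (r ^ i)" for g i
    using ex[OF that(1)] e[OF that(1)] that by blast
  have e_mult: "e (g \<otimes> h) = (e g + e h) mod (p - 1)" if g: "g \<in> carrier G" and h: "h \<in> carrier G" for g h
  proof (rule e_unique)
    show "g \<otimes> h \<in> carrier G" using g h by simp
    show "(e g + e h) mod (p - 1) < p - 1" using p1 by simp
    let ?s = "e g + e h"
    have "r ^ ?s = r ^ ((p - 1) * (?s div (p - 1)) + ?s mod (p - 1))" by simp
    also have "\<dots> = (r ^ (p - 1)) ^ (?s div (p - 1)) * r ^ (?s mod (p - 1))"
      by (simp only: power_add power_mult)
    also have "\<dots> mod p = ((r ^ (p - 1) mod p) ^ (?s div (p - 1)) mod p * r ^ (?s mod (p - 1))) mod p"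
      by (simp only: power_mod mod_mult_left_eq)
    also have "\<dots> = r ^ (?s mod (p - 1)) mod p" unfolding r_pow using p1 by simp
    finally have mod_eq: "r ^ ?s mod p = r ^ (?s mod (p - 1)) mod p" .
    have "g \<otimes> h \<otimes> z \<otimes> inv (g \<otimes> h) = g \<otimes> (h \<otimes> z \<otimes> inv h) \<otimes> inv g"
      using g h z by (simp add: m_assoc inv_mult_group)
    also have "\<dots> = (g \<otimes> z \<otimes> inv g) [^] (r ^ e h)"
      unfolding e(2)[OF h] using conjugate_nat_pow[OF g z] by simp
    also have "\<dots> = z [^] (r ^ ?s)"
      unfolding e(2)[OF g] using z by (simp add: nat_pow_pow power_add)
    also have "\<dots> = z [^] (r ^ ?s mod p)" by (rule nat_pow_mod[OF z zp, symmetric])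
    also have "\<dots> = z [^] (r ^ (?s mod (p - 1)))" unfolding mod_eq by (rule nat_pow_mod[OF z zp])
    finally show "g \<otimes> h \<otimes> z \<otimes> inv (g \<otimes> h) = z [^] (r ^ (?s mod (p - 1)))" .
  qed
  have "(\<lambda>g. int (e g)) \<in> hom G (integer_mod_group n)" if n: "n = p - 1" for n
  proof (rule homI)
    fix g h assume g: "g \<in> carrier G" and h: "h \<in> carrier G"
    show "int (e g) \<in> carrier (integer_mod_group n)"
      using e(1)[OF g, folded n] by (simp add: carrier_integer_mod_group)
    show "int (e (g \<otimes> h)) = int (e g) \<otimes>\<^bsub>integer_mod_group n\<^esub> int (e h)"
      using e_mult[OF g h, folded n] by (simp add: of_nat_mod)
  qed
  then have "(\<lambda>g. int (e g)) \<in> hom G (integer_mod_group (p - 1))" by blast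
  moreover have "int (e g) = 0 \<longleftrightarrow> g \<otimes> z = z \<otimes> g" if g: "g \<in> carrier G" for g
  proof -
    have "e g = 0 \<longleftrightarrow> z = g \<otimes> z \<otimes> inv g"
    proof
      assume "e g = 0"
      then show "z = g \<otimes> z \<otimes> inv g" using e(2)[OF g] z by simp
    next
      assume "z = g \<otimes> z \<otimes> inv g"
      then have "g \<otimes> z \<otimes> inv g = z [^] (r ^ 0)" using z by simp
      then show "e g = 0" using e_unique[OF g, of 0] p1 by simp
    qed
    also have "\<dots> \<longleftrightarrow> g \<otimes> z = z \<otimes> g"
      using inv_solve_right[of z "g \<otimes> z" g] g z by simp
    finally show ?thesis by simp
  qed
  ultimately show thesis using that by blast
qed

section \<open>Complements with cyclic quotient\<close>

text \<open>A subgroup of a cyclic group is cyclic. The generator is stated through a preimage \<open>g\<close>,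
  one for which \<open>\<alpha> g\<close> is the least positive value of \<open>\<alpha>\<close>.\<close>

lemma cyclic_image_generator:
  assumes n: "n > 0" and \<alpha>: "\<alpha> \<in> hom G (integer_mod_group n)"
  obtains g where "g \<in> carrier G" and "\<And>u. u \<in> carrier G \<Longrightarrow> \<exists>i::nat. \<alpha> u = \<alpha> (g [^] i)"
proof -
  interpret A: group_hom G "integer_mod_group n" \<alpha>
    using \<alpha> by (simp add: group_hom_def group_hom_axioms_def is_group)
  have range: "0 \<le> \<alpha> u" "\<alpha> u < int n" if "u \<in> carrier G" for u
    using A.hom_closed[OF that] n by (simp_all add: carrier_integer_mod_group)
  show thesis
  proof (cases "\<exists>u\<in>carrier G. \<alpha> u \<noteq> 0")
    case False
    then have "\<alpha> u = \<alpha> (\<one> [^] (0::nat))" if "u \<in> carrier G" for u using that by simp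
    then show thesis using that[of \<one>] by blast
  next
    case True
    let ?Q = "\<lambda>d. \<exists>u\<in>carrier G. \<alpha> u = int d \<and> d > 0"
    have "\<exists>d. ?Q d"
    proof -
      obtain u where "u \<in> carrier G" "\<alpha> u \<noteq> 0" using True by blast
      then have "?Q (nat (\<alpha> u))" using range[of u] by (intro bexI[of _ u]) auto
      then show ?thesis by blast
    qed
    then have least: "?Q (LEAST d. ?Q d)" by (rule LeastI_ex)
    define d where "d = (LEAST d. ?Q d)"
    obtain g where g: "g \<in> carrier G" "\<alpha> g = int d" and d: "d > 0"
      using least unfolding d_def by blast
    have "\<exists>i::nat. \<alpha> u = \<alpha> (g [^] i)" if u: "u \<in> carrier G" for u
    proof -
      define q where "q = nat (\<alpha> u) div d"
      define s where "s = nat (\<alpha> u) mod d"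
      have au: "\<alpha> u = int (d * q + s)" using range[OF u] by (simp add: q_def s_def)
      have gq: "\<alpha> (g [^] q) = int (d * q)"
      proof -
        have "\<alpha> (g [^] q) = (int q * int d) mod int n"
          using A.hom_nat_pow[OF g(1), of q] g(2) by simp
        also have "\<dots> = int (d * q)"
          using au range[OF u] by (simp add: mult.commute)
        finally show ?thesis .
      qed
      let ?w = "u \<otimes> inv (g [^] q)"
      have w: "?w \<in> carrier G" using u g by simp
      have "\<alpha> u = \<alpha> (?w \<otimes> g [^] q)" using u g by (simp add: m_assoc)
      also have "\<dots> = (\<alpha> ?w + int (d * q)) mod int n"
        using A.hom_mult[OF w, of "g [^] q"] g gq by simp
      finally have "int s mod int n = \<alpha> ?w mod int n"
        using au range[OF u] by (metis add_diff_cancel_left' add_diff_cancel_right' mod_diff_left_eq mod_mod_trivial of_nat_add)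
      moreover have "s < n"
      proof -
        have "int (d * q + s) < int n" using au range(2)[OF u] by simp
        then have "d * q + s < n" by (simp only: of_nat_less_iff)
        then show ?thesis by simp
      qed
      ultimately have aw: "\<alpha> ?w = int s" using range[OF w] by simp
      have "s < d" using d by (simp add: s_def)
      then have "s < (LEAST d. ?Q d)" by (simp only: d_def)
      then have notQ: "\<not> ?Q s" by (rule not_less_Least)
      have "s = 0"
      proof (rule ccontr)
        assume "s \<noteq> 0"
        then have "\<alpha> ?w = int s \<and> s > 0" using aw by simp
        then have "?Q s" using w by (rule bexI)
        then show False using notQ by (rule notE[rotated])
      qed
      then have "\<alpha> u = \<alpha> (g [^] q)" using au gq by simp
      then show ?thesis by (rule exI)
    qed
    from that[OF g(1) this] show thesis .
  qed
qed

text \<open>Let \<open>g\<close> generate the quotient by \<open>P\<close>, which has order \<open>m\<close>. Raising \<open>g\<close> to a multiple of the order of \<open>P\<close> that is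
  congruent to one modulo \<open>m\<close> gives an element \<open>h\<close> with the same image as \<open>g\<close> but with
  \<open>h [^] m = \<one>\<close>. So \<open>\<langle>h\<rangle>\<close> meets \<open>P\<close> trivially and covers the quotient.\<close>

lemma cyclic_coprime_complement:
  assumes fin: "finite (carrier G)" and n: "n > 0" and \<alpha>: "\<alpha> \<in> hom G (integer_mod_group n)"
    and P: "P \<lhd> G" and ker: "\<And>g. g \<in> carrier G \<Longrightarrow> \<alpha> g = 0 \<longleftrightarrow> g \<in> P"
    and ord: "order G = card P * m" and cop: "coprime (card P) m"
  shows "\<exists>H. semidirect_decomp H P G \<and>
           (\<exists>S. subgroup S (integer_mod_group n) \<and>
              G\<lparr>carrier := H\<rparr> \<cong> (integer_mod_group n)\<lparr>carrier := S\<rparr>)"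
proof -
  interpret A: group_hom G "integer_mod_group n" \<alpha>
    using \<alpha> by (simp add: group_hom_def group_hom_axioms_def is_group)
  have PG: "subgroup P G" using P by (rule normal_imp_subgroup)
  have PC: "P \<subseteq> carrier G" using PG by (rule subgroup.subset)
  interpret N: normal P G by (rule P)
  interpret F: group "G Mod P" by (rule N.factorgroup_is_group)
  have cP: "card P > 0" using PG fin by (rule subgroup.finite_imp_card_positive)
  have "order (G Mod P) = m"
    using lagrange[OF PG] ord cP by (simp add: order_def FactGroup_def)
  then have pow_m: "u [^] m \<in> P" if u: "u \<in> carrier G" for u
  proof -
    have "(P #> u) [^]\<^bsub>G Mod P\<^esub> m = P"
      using F.pow_order_eq_1[of "P #> u"] \<open>order (G Mod P) = m\<close> u
      by (simp add: carrier_FactGroup)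
    then have "P #> (u [^] m) = P" using N.FactGroup_pow[OF u] by simp
    then show ?thesis using coset_join1[of P "u [^] m"] u PC PG by simp
  qed
  obtain g where g: "g \<in> carrier G" and gen: "\<And>u. u \<in> carrier G \<Longrightarrow> \<exists>i::nat. \<alpha> u = \<alpha> (g [^] i)"
    using cyclic_image_generator[OF n \<alpha>] by blast
  obtain s where s: "[card P * s = Suc 0] (mod m)" using cong_solve_coprime_nat[OF cop] by blast
  let ?I = "integer_mod_group n"
  define h where "h = g [^] (card P * s)"
  have h: "h \<in> carrier G" using g by (simp add: h_def)
  have "h [^] m = ((g [^] m) [^] card P) [^] s"
    using g by (simp add: h_def nat_pow_pow mult.commute mult.left_commute)
  also have "\<dots> = \<one>" using pow_card_subgroup_eq_one[OF PG pow_m[OF g]] by simp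
  finally have hm: "h [^] m = \<one>" .
  have ag: "\<alpha> g \<in> carrier ?I" using A.hom_closed[OF g] .
  have agm: "\<alpha> g [^]\<^bsub>?I\<^esub> m = \<one>\<^bsub>?I\<^esub>"
    using A.hom_nat_pow[OF g, of m] ker[of "g [^] m"] pow_m[OF g] g by (metis nat_pow_closed one_integer_mod_group)
  \<comment> \<open>The image of \<open>g\<close> has order dividing \<open>m\<close>, and the exponent of \<open>h\<close> is one modulo \<open>m\<close>.\<close>
  have ah: "\<alpha> h = \<alpha> g"
  proof -
    have "\<alpha> h = \<alpha> g [^]\<^bsub>?I\<^esub> (card P * s)" unfolding h_def by (rule A.hom_nat_pow[OF g])
    also have "\<dots> = \<alpha> g [^]\<^bsub>?I\<^esub> ((card P * s) mod m)"
      using A.H.nat_pow_mod[OF ag agm] by metis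
    also have "\<dots> = \<alpha> g [^]\<^bsub>?I\<^esub> (Suc 0 mod m)" using s by (simp only: cong_def)
    also have "\<dots> = \<alpha> g [^]\<^bsub>?I\<^esub> Suc 0" using A.H.nat_pow_mod[OF ag agm] by metis
    also have "\<dots> = \<alpha> g" using ag A.H.nat_pow_eone by simp
    finally show ?thesis .
  qed
  let ?H = "generate G {h}"
  note H = generate_single_subgroup[OF h]
  have HC: "?H \<subseteq> carrier G" using H(1) by (rule subgroup.subset)
  have int: "?H \<inter> P = {\<one>}"
  proof
    show "{\<one>} \<subseteq> ?H \<inter> P" using subgroup.one_closed[OF H(1)] subgroup.one_closed[OF PG] by blast
    show "?H \<inter> P \<subseteq> {\<one>}"
    proof
      fix u assume u: "u \<in> ?H \<inter> P"
      then obtain i :: nat where i: "u = h [^] i" using mem_generate_single_iff[OF fin h] by blast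
      have "u [^] m = (h [^] m) [^] i" using h by (simp add: i nat_pow_pow mult.commute)
      then have "u [^] m = \<one>" using hm by simp
      moreover have "u [^] card P = \<one>" using pow_card_subgroup_eq_one[OF PG] u by blast
      ultimately have "u = \<one>"
        using eq_one_if_coprime_pows_eq_one[of u "card P" m] cop u PC by blast
      then show "u \<in> {\<one>}" by simp
    qed
  qed
  have "?H <#> P = carrier G"
  proof
    show "?H <#> P \<subseteq> carrier G" using setmult_subset_G[OF HC PC] .
    show "carrier G \<subseteq> ?H <#> P"
    proof
      fix u assume u: "u \<in> carrier G"
      obtain i :: nat where i: "\<alpha> u = \<alpha> (g [^] i)" using gen[OF u] by blast
      have "\<alpha> (h [^] i) = \<alpha> u"
        unfolding i A.hom_nat_pow[OF h] A.hom_nat_pow[OF g] ah ..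
      then have "\<alpha> (inv (h [^] i) \<otimes> u) = \<one>\<^bsub>?I\<^esub>"
        using A.hom_mult[of "inv (h [^] i)" u] A.hom_inv[of "h [^] i"] h u A.hom_closed[OF u]
          A.H.l_inv by (metis inv_closed nat_pow_closed)
      then have "inv (h [^] i) \<otimes> u \<in> P"
        unfolding one_integer_mod_group by (rule iffD1[OF ker, rotated]) (use h u in simp)
      moreover have "h [^] i \<in> ?H" using subgroup_nat_pow_closed[OF H] .
      moreover have "u = h [^] i \<otimes> (inv (h [^] i) \<otimes> u)" using h u by (simp add: mult_inv_cancel_left)
      ultimately show "u \<in> ?H <#> P" unfolding set_mult_def by blast
    qed
  qed
  then have dec: "semidirect_decomp ?H P G"
    using H(1) P int by (simp add: semidirect_decomp_def)
  let ?S = "\<alpha> ` ?H"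
  have S: "subgroup ?S ?I" using A.subgroup_img_is_subgroup[OF H(1)] .
  have "inj_on \<alpha> ?H"
  proof (rule inj_onI)
    fix u w assume uw: "u \<in> ?H" "w \<in> ?H" "\<alpha> u = \<alpha> w"
    have C: "u \<in> carrier G" "w \<in> carrier G" using uw HC by auto
    have "\<alpha> (u \<otimes> inv w) = \<one>\<^bsub>?I\<^esub>"
      using A.hom_mult[of u "inv w"] A.hom_inv[of w] C uw(3) A.hom_closed[OF C(2)] A.H.r_inv
      by (metis inv_closed)
    then have "u \<otimes> inv w \<in> P"
      unfolding one_integer_mod_group by (rule iffD1[OF ker, rotated]) (use C in simp)
    moreover have "u \<otimes> inv w \<in> ?H"
      using uw subgroup.m_closed[OF H(1)] subgroup.m_inv_closed[OF H(1)] by blast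
    ultimately have "u \<otimes> inv w = \<one>" using int by blast
    then show "u = w" using C by (metis inv_equality inv_inv inv_closed)
  qed
  then have "\<alpha> \<in> iso (G\<lparr>carrier := ?H\<rparr>) (?I\<lparr>carrier := ?S\<rparr>)"
    using A.hom_mult HC by (auto simp: iso_def hom_def bij_betw_def subset_iff)
  then have "G\<lparr>carrier := ?H\<rparr> \<cong> ?I\<lparr>carrier := ?S\<rparr>" by (auto simp: is_iso_def)
  then show ?thesis using dec S by blast
qed

lemma generate_single_iso_integer_mod_group:
  assumes fin: "finite (carrier G)" and x: "x \<in> carrier G"
  shows "G\<lparr>carrier := generate G {x}\<rparr> \<cong> integer_mod_group (ord x)"
proof -
  let ?X = "generate G {x}" and ?I = "integer_mod_group (ord x)"
  have pos: "ord x > 0" using ord_ge_1[OF fin x] by simp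
  let ?f = "\<lambda>i::int. x [^] nat i"
  have carr: "carrier ?I = {0..<int (ord x)}" using pos by (simp add: carrier_integer_mod_group)
  have "?f \<in> iso ?I (G\<lparr>carrier := ?X\<rparr>)"
    unfolding iso_def
  proof (intro CollectI conjI)
    show "?f \<in> hom ?I (G\<lparr>carrier := ?X\<rparr>)"
    proof (rule homI)
      fix i assume "i \<in> carrier ?I"
      then show "?f i \<in> carrier (G\<lparr>carrier := ?X\<rparr>)"
        using mem_generate_single_iff[OF fin x] by auto
    next
      fix i j assume "i \<in> carrier ?I" "j \<in> carrier ?I"
      then have "0 \<le> i" "0 \<le> j" by (auto simp: carr)
      then have "nat ((i + j) mod int (ord x)) = (nat i + nat j) mod ord x"
        by (simp add: nat_mod_distrib nat_add_distrib)
      then show "?f (i \<otimes>\<^bsub>?I\<^esub> j) = ?f i \<otimes>\<^bsub>G\<lparr>carrier := ?X\<rparr>\<^esub> ?f j"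
        using nat_pow_mod[OF x pow_ord_eq_1[OF x], of "nat i + nat j"] x by (simp add: nat_pow_mult)
    qed
    show "bij_betw ?f (carrier ?I) (carrier (G\<lparr>carrier := ?X\<rparr>))"
      unfolding bij_betw_def
    proof
      show "inj_on ?f (carrier ?I)"
      proof (rule inj_onI)
        fix i j assume ij: "i \<in> carrier ?I" "j \<in> carrier ?I" "?f i = ?f j"
        then have "nat i < ord x" "nat j < ord x" by (auto simp: carr)
        then have "nat i = nat j" using nat_pow_eq_imp_mod_eq[OF fin x ij(3)] by simp
        then show "i = j" using ij by (auto simp: carr)
      qed
      show "?f ` carrier ?I = carrier (G\<lparr>carrier := ?X\<rparr>)"
      proof
        show "?f ` carrier ?I \<subseteq> carrier (G\<lparr>carrier := ?X\<rparr>)"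
          using mem_generate_single_iff[OF fin x] by auto
        show "carrier (G\<lparr>carrier := ?X\<rparr>) \<subseteq> ?f ` carrier ?I"
        proof
          fix y assume "y \<in> carrier (G\<lparr>carrier := ?X\<rparr>)"
          then obtain i :: nat where i: "y = x [^] i"
            using mem_generate_single_iff[OF fin x] by auto
          then have "y = ?f (int (i mod ord x))"
            using nat_pow_mod[OF x pow_ord_eq_1[OF x], of i] by (simp del: of_nat_mod add: nat_int)
          moreover have "int (i mod ord x) \<in> carrier ?I" using pos by (simp add: carr)
          ultimately show "y \<in> ?f ` carrier ?I" by blast
        qed
      qed
    qed
  qed
  then have "?I \<cong> G\<lparr>carrier := ?X\<rparr>" by (auto simp: is_iso_def)
  then show ?thesis by (rule group.iso_sym[OF group_integer_mod_group])
qed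

section \<open>A presentation of the quaternion group\<close>

text \<open>The relations give every product in the normal form \<open>z\<^sup>a x\<^sup>b y\<^sup>c\<close>, so
  \<open>i \<mapsto> x\<close>, \<open>j \<mapsto> y\<close>, \<open>-1 \<mapsto> z\<close> defines a homomorphism from the quaternion group. It is surjective
  and the orders agree.\<close>

lemma iso_Q8I:
  assumes C: "x \<in> carrier G" "y \<in> carrier G" "z \<in> carrier G"
    and xx: "x \<otimes> x = z" and yy: "y \<otimes> y = z" and zz: "z \<otimes> z = \<one>" and yx: "y \<otimes> x = z \<otimes> (x \<otimes> y)"
    and card: "card (carrier G) = 8"
    and elems: "carrier G \<subseteq> {\<one>, z, x, z \<otimes> x, y, z \<otimes> y, x \<otimes> y, z \<otimes> (x \<otimes> y)}"
  shows "G \<cong> Q8"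
proof -
  have xz: "x \<otimes> z = z \<otimes> x" unfolding xx[symmetric] using C by (simp add: m_assoc)
  have yz: "y \<otimes> z = z \<otimes> y" unfolding yy[symmetric] using C by (simp add: m_assoc)
  have ext: "x \<otimes> (x \<otimes> w) = z \<otimes> w" "y \<otimes> (y \<otimes> w) = z \<otimes> w" "z \<otimes> (z \<otimes> w) = w"
    "x \<otimes> (z \<otimes> w) = z \<otimes> (x \<otimes> w)" "y \<otimes> (z \<otimes> w) = z \<otimes> (y \<otimes> w)"
    "y \<otimes> (x \<otimes> w) = z \<otimes> (x \<otimes> (y \<otimes> w))" if "w \<in> carrier G" for w
    using C that xx yy zz xz yz yx by (simp_all flip: m_assoc)
  note rules = xx yy zz xz yz yx ext m_assoc
  define f where "f q = (if q = (1,0,0,0) then \<one> else if q = (-1,0,0,0) then z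
      else if q = (0,1,0,0) then x else if q = (0,-1,0,0) then z \<otimes> x
      else if q = (0,0,1,0) then y else if q = (0,0,-1,0) then z \<otimes> y
      else if q = (0,0,0,1) then x \<otimes> y else z \<otimes> (x \<otimes> y))" for q :: "int \<times> int \<times> int \<times> int"
  have closed: "f q \<in> carrier G" if "q \<in> carrier Q8" for q
    using C by (simp add: f_def)
  have hom: "f (q \<otimes>\<^bsub>Q8\<^esub> q') = f q \<otimes> f q'" if "q \<in> carrier Q8" "q' \<in> carrier Q8" for q q'
    using that C unfolding Q8_def
    by (simp, elim disjE) (simp_all add: f_def rules)
  have img: "f ` carrier Q8 = carrier G"
  proof
    show "f ` carrier Q8 \<subseteq> carrier G" using closed by blast
    have "{\<one>, z, x, z \<otimes> x, y, z \<otimes> y, x \<otimes> y, z \<otimes> (x \<otimes> y)} \<subseteq> f ` carrier Q8"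
      by (simp add: Q8_def f_def)
    then show "carrier G \<subseteq> f ` carrier Q8" using elems by blast
  qed
  have "finite (carrier Q8)" by (simp add: Q8_def)
  moreover have "card (f ` carrier Q8) = card (carrier Q8)"
    using img card order_Q8 by (simp add: order_def)
  ultimately have "inj_on f (carrier Q8)" by (rule eq_card_imp_inj_on)
  then have "f \<in> iso Q8 G"
    using closed hom img by (auto simp: iso_def hom_def bij_betw_def)
  then have "Q8 \<cong> G" by (auto simp: is_iso_def)
  then show ?thesis by (rule group.iso_sym[OF group_Q8])
qed

section \<open>Powers of products with central commutator\<close>

text \<open>Moving one \<open>v\<close> to the left past \<open>y [^] n\<close> costs \<open>n\<close> copies of the commutator \<open>c\<close>; collecting
  \<open>(v \<otimes> y) [^] n\<close> costs \<open>0 + 1 + \<dots> + (n - 1)\<close> copies in total.\<close>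

lemma pow_mult_commutator:
  assumes C: "v \<in> carrier G" "y \<in> carrier G" "c \<in> carrier G"
    and c: "y \<otimes> v = v \<otimes> y \<otimes> c" and cv: "c \<otimes> v = v \<otimes> c" and cy: "c \<otimes> y = y \<otimes> c"
  shows "y [^] (n::nat) \<otimes> v = v \<otimes> y [^] n \<otimes> c [^] n"
    and "(v \<otimes> y) [^] n = v [^] n \<otimes> y [^] n \<otimes> c [^] (n choose 2)"
proof -
  have powv: "c [^] i \<otimes> v = v \<otimes> c [^] i" for i :: nat
    using nat_pow_commute[OF C(3,1) cv] .
  have powy: "c [^] i \<otimes> y = y \<otimes> c [^] i" for i :: nat
    using nat_pow_commute[OF C(3,2) cy] .
  show *: "y [^] n \<otimes> v = v \<otimes> y [^] n \<otimes> c [^] n" for n :: nat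
  proof (induction n)
    case (Suc n)
    have "y [^] Suc n \<otimes> v = y [^] n \<otimes> v \<otimes> (y \<otimes> c)"
      using C c by (simp add: m_assoc)
    also have "\<dots> = v \<otimes> y [^] n \<otimes> (c [^] n \<otimes> y) \<otimes> c"
      using C Suc by (simp add: m_assoc)
    also have "\<dots> = v \<otimes> y [^] Suc n \<otimes> c [^] Suc n"
      unfolding powy using C by (simp add: m_assoc)
    finally show ?case .
  qed (use C in simp)
  show "(v \<otimes> y) [^] n = v [^] n \<otimes> y [^] n \<otimes> c [^] (n choose 2)"
  proof (induction n)
    case (Suc n)
    have "(v \<otimes> y) [^] Suc n = v [^] n \<otimes> y [^] n \<otimes> (c [^] (n choose 2) \<otimes> v) \<otimes> y"
      using C Suc by (simp add: m_assoc)
    also have "\<dots> = v [^] n \<otimes> (y [^] n \<otimes> v) \<otimes> (c [^] (n choose 2) \<otimes> y)"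
      unfolding powv using C by (simp add: m_assoc)
    also have "\<dots> = v [^] n \<otimes> (v \<otimes> y [^] n \<otimes> c [^] n) \<otimes> (y \<otimes> c [^] (n choose 2))"
      unfolding * powy ..
    also have "\<dots> = v [^] n \<otimes> v \<otimes> y [^] n \<otimes> (c [^] n \<otimes> y) \<otimes> c [^] (n choose 2)"
      using C by (simp add: m_assoc)
    also have "\<dots> = v [^] n \<otimes> v \<otimes> (y [^] n \<otimes> y) \<otimes> (c [^] n \<otimes> c [^] (n choose 2))"
      unfolding powy using C by (simp add: m_assoc)
    also have "\<dots> = v [^] Suc n \<otimes> y [^] Suc n \<otimes> c [^] (Suc n choose 2)"
      using C by (simp add: nat_pow_mult numeral_2_eq_2)
    finally show ?case .
  qed (use C in \<open>simp add: numeral_2_eq_2\<close>)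
qed

end

section \<open>Groups of critical type\<close>

locale critical_group = group G for G (structure) +
  fixes p k :: nat
  assumes finite: "finite (carrier G)"
    and prime: "Factorial_Ring.prime p"
    and dvd_order: "p ^ k dvd order G"
    and critical: "critical_type p k G"
begin

abbreviation Frat ("\<Phi>") where "\<Phi> \<equiv> frattini G"

lemma two_le_k: "k \<ge> 2" and core: "p_prime_core p G = {\<one>}"
  and card_Frat: "card \<Phi> = p ^ (k - 1)" and M_class: "M_class (p ^ k) G"
  using critical by (auto simp: critical_type_def)

lemma Frat_subgroup: "subgroup \<Phi> G"
  using frattini_normal by (rule normal_imp_subgroup)

lemma Frat_carrier: "\<Phi> \<subseteq> carrier G"
  using Frat_subgroup by (rule subgroup.subset)

lemma p_gt_1: "p > 1" using prime by (rule prime_gt_1_nat)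

lemma p_times_card_Frat: "p * card \<Phi> = p ^ k"
  using two_le_k by (simp add: card_Frat flip: power_Suc)

text \<open>The order of \<open>H = \<Phi> <#> \<langle>x\<rangle>\<close> is a power of \<open>p\<close>. It exceeds \<open>p ^ (k - 1)\<close>, as \<open>x\<close> is not in \<open>\<Phi>\<close>, and is at most
  \<open>p ^ k\<close>, as \<open>x [^] p\<close> is in \<open>\<Phi>\<close>. So \<open>H\<close> is one of the subgroups that have a supplement.\<close>

lemma root_of_Frat:
  assumes x: "x \<in> carrier G" "x \<notin> \<Phi>" "x [^] p \<in> \<Phi>"
  shows "ord x = p ^ k" and "\<Phi> \<subseteq> generate G {x}" and "\<Phi> = generate G {x [^] p}"
    and "\<exists>M. subgroup M G \<and> \<Phi> \<subseteq> M \<and> x \<notin> M \<and> generate G {x} <#> M = carrier G"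
proof -
  let ?X = "generate G {x}"
  let ?H = "\<Phi> <#> ?X"
  note X = generate_single_subgroup[OF x(1)]
  have H: "subgroup ?H G" using mult_norm_subgroup[OF frattini_normal X(1)] .
  have FH: "\<Phi> \<subseteq> ?H" using subset_set_mult_right[OF Frat_carrier X(1)] .
  have XH: "?X \<subseteq> ?H" using subset_set_mult_left[OF subgroup.subset[OF X(1)] Frat_subgroup] .
  then have xH: "x \<in> ?H" using X(2) by blast
  have finH: "finite ?H" using subgroup.subset[OF H] finite finite_subset by blast
  have "x [^] (p ^ k) = (x [^] p) [^] card \<Phi>"
    using x by (simp add: nat_pow_pow p_times_card_Frat)
  also have "\<dots> = \<one>" using pow_card_subgroup_eq_one[OF Frat_subgroup x(3)] .
  finally have ord_dvd: "ord x dvd p ^ k" using x by (simp add: pow_eq_id)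
  have "card ?H dvd card \<Phi> * card ?X"
    using card_normal_set_mult_dvd[OF frattini_normal X(1)] .
  also have "\<dots> dvd p ^ (k - 1) * p ^ k"
    using ord_dvd generate_pow_card[OF x(1)] card_Frat by simp
  finally have "card ?H dvd p ^ (k - 1 + k)" by (simp add: power_add)
  then obtain j where j: "card ?H = p ^ j" using divides_primepow_nat[OF prime] by blast
  have "?H \<subseteq> (\<lambda>(f, i). f \<otimes> x [^] i) ` (\<Phi> \<times> {..<p})"
  proof
    fix h assume "h \<in> ?H"
    then obtain f y where f: "f \<in> \<Phi>" "y \<in> ?X" "h = f \<otimes> y" by (auto simp: set_mult_def)
    then obtain i :: nat where i: "y = x [^] i"
      using mem_generate_single_iff[OF finite x(1)] by blast
    have "x [^] i = x [^] (p * (i div p) + i mod p)" by simp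
    also have "\<dots> = (x [^] p) [^] (i div p) \<otimes> x [^] (i mod p)"
      using x(1) by (simp only: nat_pow_mult[symmetric] nat_pow_pow)
    finally have "h = (f \<otimes> (x [^] p) [^] (i div p)) \<otimes> x [^] (i mod p)"
      using f i x(1) Frat_carrier by (auto simp: m_assoc)
    moreover have "f \<otimes> (x [^] p) [^] (i div p) \<in> \<Phi>"
      using subgroup.m_closed[OF Frat_subgroup f(1) subgroup_nat_pow_closed[OF Frat_subgroup x(3)]] .
    moreover have "i mod p < p" using p_gt_1 by simp
    ultimately show "h \<in> (\<lambda>(f, i). f \<otimes> x [^] i) ` (\<Phi> \<times> {..<p})" by force
  qed
  then have "card ?H \<le> card (\<Phi> \<times> {..<p})"
    using finite_subset[OF Frat_carrier finite] by (intro surj_card_le) auto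
  then have "p ^ j \<le> p ^ k"
    using j p_times_card_Frat by (simp add: card_cartesian_product mult.commute)
  moreover have "p ^ (k - 1) < p ^ j"
    using psubset_card_mono[OF finH, of \<Phi>] FH xH x(2) j card_Frat by auto
  ultimately have "j = k" using p_gt_1 by simp
  then have cardH: "card ?H = p ^ k" using j by simp
  have supp: "M_supplemented ?H G" using M_class H cardH by (simp add: M_class_def)
  have "card ?H = p * card \<Phi>" using cardH p_times_card_Frat by simp
  note over = M_supplemented_over_frattini[OF finite H supp prime FH this xH x(2)]
  show ord: "ord x = p ^ k" using over(1) cardH generate_pow_card[OF x(1)] by simp
  show "\<Phi> \<subseteq> ?X" using over(1) FH by simp
  show "\<exists>M. subgroup M G \<and> \<Phi> \<subseteq> M \<and> x \<notin> M \<and> ?X <#> M = carrier G"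
    using over by simp
  have "p dvd ord x" using ord two_le_k by simp
  then have "ord (x [^] p) = p ^ (k - 1)"
    using ord_pow[OF x(1)] p_gt_1 ord two_le_k by (simp add: power_diff)
  then have "card (generate G {x [^] p}) = card \<Phi>"
    using generate_pow_card[of "x [^] p"] x(1) card_Frat by simp
  moreover have "generate G {x [^] p} \<subseteq> \<Phi>"
    using generate_single_subset_iff[OF Frat_subgroup, of "x [^] p"] x by simp
  ultimately show "\<Phi> = generate G {x [^] p}"
    using finite_subset[OF Frat_carrier finite] card_subset_eq by metis
qed

text \<open>Outside \<open>\<Phi>\<close> such an element would have order \<open>p ^ k\<close>, which is larger than \<open>p\<close>.\<close>

lemma exponent_p_in_Frat:
  assumes "g \<in> carrier G" and "g [^] p = \<one>"
  shows "g \<in> \<Phi>"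
proof (rule ccontr)
  assume "g \<notin> \<Phi>"
  then have "ord g = p ^ k"
    using root_of_Frat(1)[of g] assms subgroup.one_closed[OF Frat_subgroup] by simp
  moreover have "ord g dvd p" using assms by (simp add: pow_eq_id)
  ultimately have "p ^ k dvd p ^ 1" by simp
  then have "k \<le> 1" using p_gt_1 power_dvd_imp_le by blast
  then show False using two_le_k by simp
qed

text \<open>All elements of order \<open>p\<close> lie in \<open>\<Phi>\<close>, hence in the cyclic group \<open>\<langle>x\<rangle>\<close>, which has only one subgroup of
  order \<open>p\<close>. Being defined by an equation, this subgroup is normal.\<close>

lemma order_p_subgroup:
  assumes x: "x \<in> carrier G" "x \<notin> \<Phi>" "x [^] p \<in> \<Phi>"
  defines "z \<equiv> x [^] (p ^ (k - 1))"
  shows "z \<in> carrier G" and "ord z = p" and "generate G {z} = {g \<in> carrier G. g [^] p = \<one>}"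
proof -
  show z: "z \<in> carrier G" using x by (simp add: z_def)
  have ordx: "ord x = p ^ (k - 1) * p"
    using root_of_Frat(1)[OF x] two_le_k by (simp flip: power_Suc2)
  then show ordz: "ord z = p"
    unfolding z_def using ord_pow[OF x(1), of "p ^ (k - 1)"] p_gt_1 by simp
  show "generate G {z} = {g \<in> carrier G. g [^] p = \<one>}"
  proof (intro equalityI subsetI)
    fix g assume g: "g \<in> generate G {z}"
    then obtain i :: nat where i: "g = z [^] i" using mem_generate_single_iff[OF finite z] by blast
    have "g [^] p = (z [^] p) [^] i" using z by (simp add: i nat_pow_pow mult.commute)
    also have "\<dots> = \<one>" using pow_ord_eq_1[OF z] ordz by simp
    finally show "g \<in> {g \<in> carrier G. g [^] p = \<one>}" using z i by simp
  next
    fix g assume "g \<in> {g \<in> carrier G. g [^] p = \<one>}"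
    then have g: "g \<in> carrier G" "g [^] p = \<one>" by auto
    then have "g \<in> generate G {x}" using exponent_p_in_Frat root_of_Frat(2)[OF x] by blast
    then obtain i :: nat where i: "g = x [^] i" using mem_generate_single_iff[OF finite x(1)] by blast
    have "x [^] (i * p) = \<one>" using g(2) i x(1) by (simp add: nat_pow_pow)
    then have "p ^ (k - 1) * p dvd i * p" using ordx x(1) by (simp add: pow_eq_id)
    then have "p ^ (k - 1) dvd i" using p_gt_1 by simp
    then obtain j where "i = p ^ (k - 1) * j" by (auto elim: dvdE)
    then have "g = z [^] j" using i x(1) by (simp add: z_def nat_pow_pow)
    then show "g \<in> generate G {z}" using mem_generate_single_iff[OF finite z] by blast
  qed
qed

end

section \<open>The structure of a Sylow subgroup\<close>

locale critical_sylow = critical_group +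
  fixes P :: "'a set" and a m :: nat
  assumes P: "subgroup P G" and card_P: "card P = p ^ a"
    and order_eq: "order G = p ^ a * m" and not_dvd: "\<not> p dvd m"
begin

lemma P_carrier: "P \<subseteq> carrier G" using P by (rule subgroup.subset)

lemma finite_P: "Finite_Set.finite P" using P_carrier finite finite_subset by blast

text \<open>The product of the normal \<open>p\<close>-subgroup \<open>\<Phi>\<close> with \<open>P\<close> is a \<open>p\<close>-group, so it cannot be larger than \<open>P\<close>.\<close>

lemma Frat_subset_P: "\<Phi> \<subseteq> P"
proof -
  let ?H = "\<Phi> <#> P"
  have H: "subgroup ?H G" using mult_norm_subgroup[OF frattini_normal P] .
  have "card ?H dvd card \<Phi> * card P" using card_normal_set_mult_dvd[OF frattini_normal P] .
  then have "card ?H dvd p ^ (k - 1 + a)" by (simp add: card_Frat card_P power_add)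
  then obtain j where j: "card ?H = p ^ j" using divides_primepow_nat[OF prime] by blast
  have "coprime (p ^ j) m" using prime not_dvd by (simp add: prime_imp_coprime)
  moreover have "p ^ j dvd p ^ a * m"
    using card_subgroup_dvd_order[OF H] j order_eq by simp
  ultimately have "p ^ j dvd p ^ a" by (simp add: coprime_dvd_mult_left_iff)
  then have "card ?H \<le> card P" using j card_P p_gt_1 by (simp add: dvd_imp_le)
  moreover have "P \<subseteq> ?H" using subset_set_mult_left[OF P_carrier Frat_subgroup] .
  moreover have "Finite_Set.finite ?H" using subgroup.subset[OF H] finite finite_subset by blast
  ultimately have "P = ?H" by (simp add: card_seteq)
  then show ?thesis using subset_set_mult_right[OF Frat_carrier P] by simp
qed

lemma k_le_a: "k \<le> a"
proof -
  have "coprime (p ^ k) m" using prime not_dvd by (simp add: prime_imp_coprime)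
  then have "p ^ k dvd p ^ a"
    using dvd_order order_eq by (simp add: coprime_dvd_mult_left_iff)
  then show ?thesis using p_gt_1 by (auto dest: power_dvd_imp_le)
qed

lemma exists_outside_Frat: obtains x where "x \<in> P" and "x \<notin> \<Phi>"
proof -
  have "card \<Phi> < card P"
    unfolding card_Frat card_P using k_le_a two_le_k p_gt_1 by (intro power_strict_increasing) auto
  then have "\<not> P \<subseteq> \<Phi>" using card_mono[OF finite_subset[OF Frat_carrier finite], of P] by auto
  then show thesis using that by blast
qed

text \<open>\<open>M\<close> is the subgroup found in \<open>root_of_Frat\<close>. Since \<open>\<langle>x\<rangle> <#> M\<close> is everything, \<open>P\<close> is the union of the
  cosets of \<open>Q = P \<inter> M\<close> by the powers of \<open>x\<close>; as \<open>x [^] p\<close> is in \<open>M\<close> and \<open>x\<close> is not, \<open>Q\<close> has index \<open>p\<close>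
  in \<open>P\<close> and is normal there. The quotient is generated by the image of \<open>x\<close>, so it is abelian of exponent \<open>p\<close>,
  and \<open>M\<close> contains all \<open>p\<close>-th powers and all commutators of \<open>P\<close>.\<close>

lemma maximal_trace:
  assumes x: "x \<in> P" "x \<notin> \<Phi>" "x [^] p \<in> \<Phi>"
  obtains M where "subgroup M G" and "\<Phi> \<subseteq> M" and "x \<notin> M" and "generate G {x} <#> M = carrier G"
    and "card P = p * card (P \<inter> M)" and "\<And>w. w \<in> P \<Longrightarrow> w [^] p \<in> M"
    and "\<And>u v. u \<in> P \<Longrightarrow> v \<in> P \<Longrightarrow> inv (v \<otimes> u) \<otimes> (u \<otimes> v) \<in> M"
proof -
  have xC: "x \<in> carrier G" using x P_carrier by blast
  obtain M where M: "subgroup M G" "\<Phi> \<subseteq> M" "x \<notin> M" "generate G {x} <#> M = carrier G"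
    using root_of_Frat(4)[OF xC x(2,3)] by blast
  let ?Q = "P \<inter> M" and ?P = "G\<lparr>carrier := P\<rparr>"
  interpret P0: group ?P using P by (rule subgroup_imp_group)
  have MC: "M \<subseteq> carrier G" using M(1) by (rule subgroup.subset)
  have Q: "subgroup ?Q G" using P M(1) by (rule subgroups_Inter_pair)
  have QP: "subgroup ?Q ?P" using subgroup_incl[OF Q P] by simp
  have decomp: "\<exists>i<p. \<exists>q\<in>?Q. w = x [^] i \<otimes> q" if w: "w \<in> P" for w
  proof -
    have wC: "w \<in> carrier G" using w P_carrier by blast
    then have "w \<in> generate G {x} <#> M" using M(4) by simp
    then obtain y n where y: "y \<in> generate G {x}" "n \<in> M" "w = y \<otimes> n"
      by (auto simp: set_mult_def)
    then obtain i :: nat where i: "y = x [^] i" using mem_generate_single_iff[OF finite xC] by blast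
    have nC: "n \<in> carrier G" using y MC by blast
    let ?q = "(x [^] p) [^] (i div p) \<otimes> n"
    have "x [^] i = x [^] (i mod p + p * (i div p))" by simp
    also have "\<dots> = x [^] (i mod p) \<otimes> (x [^] p) [^] (i div p)"
      using xC by (simp only: nat_pow_mult[symmetric] nat_pow_pow)
    finally have eq: "w = x [^] (i mod p) \<otimes> ?q"
      using y i xC nC by (simp add: m_assoc)
    have qM: "?q \<in> M"
      using subgroup.m_closed[OF M(1) subgroup_nat_pow_closed[OF M(1)]] x(3) M(2) y(2) by blast
    then have qC: "?q \<in> carrier G" using MC by blast
    have "inv (x [^] (i mod p)) \<otimes> w = ?q"
      using eq xC qC by (simp add: mult_inv_cancel_left)
    moreover have "inv (x [^] (i mod p)) \<otimes> w \<in> P"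
      using subgroup.m_closed[OF P subgroup.m_inv_closed[OF P subgroup_nat_pow_closed[OF P x(1)]] w] .
    ultimately have "?q \<in> P" by simp
    moreover have "i mod p < p" using p_gt_1 by simp
    ultimately show ?thesis using eq qM by blast
  qed
  have card_eq: "card P = p * card ?Q"
  proof -
    obtain b where b: "card P = card ?Q * b"
      using card_subgroup_dvd_card_subgroup[OF Q P] by (auto elim: dvdE)
    have "?Q \<subset> P" using x M(3) by blast
    then have "b \<noteq> 1" using psubset_card_mono[OF finite_P, of ?Q] b by auto
    moreover have "b dvd p ^ a" using b card_P by (metis dvd_triv_right)
    ultimately have "p dvd b"
      using divides_primepow_nat[OF prime, of b a] by (metis dvd_power le_zero_eq neq0_conv power_0)
    moreover have "b \<noteq> 0" using b card_P p_gt_1 by (auto intro: ccontr)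
    ultimately have ge: "p \<le> b" by (simp add: dvd_imp_le)
    have "P \<subseteq> (\<lambda>(i, q). x [^] i \<otimes> q) ` ({..<p} \<times> ?Q)" using decomp by force
    then have "card P \<le> card ({..<p} \<times> ?Q)" using finite_P by (intro surj_card_le) auto
    then have "card P \<le> p * card ?Q" by (simp add: card_cartesian_product)
    moreover have "p * card ?Q \<le> card P" using ge b by (simp add: mult.commute)
    ultimately show ?thesis by (rule le_antisym)
  qed
  have "?Q \<lhd> ?P"
    using P0.prime_index_subgroup_normal[OF _ prime _ QP] finite_P card_P card_eq
    by (simp add: order_def)
  then interpret QN: normal ?Q ?P .
  let ?\<phi> = "\<lambda>w. ?Q #>\<^bsub>?P\<^esub> w" and ?F = "?P Mod ?Q"
  interpret h: group_hom ?P ?F ?\<phi>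
    using QN.r_coset_hom_Mod QN.factorgroup_is_group P0.is_group
    by (simp add: group_hom_def group_hom_axioms_def)
  have ker: "?\<phi> w = \<one>\<^bsub>?F\<^esub> \<longleftrightarrow> w \<in> ?Q" if "w \<in> P" for w
  proof
    assume "?\<phi> w = \<one>\<^bsub>?F\<^esub>"
    then show "w \<in> ?Q" using P0.coset_join1[OF _ _ QP, of w] that by simp
  next
    assume "w \<in> ?Q"
    then show "?\<phi> w = \<one>\<^bsub>?F\<^esub>" using P0.coset_join2[OF _ QP, of w] that by simp
  qed
  have \<phi>_pow: "\<exists>i::nat. ?\<phi> w = ?\<phi> x [^]\<^bsub>?F\<^esub> i" if w: "w \<in> P" for w
  proof -
    obtain i :: nat and q where i: "q \<in> ?Q" "w = x [^] i \<otimes> q" using decomp[OF w] by blast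
    have xi: "x [^] i \<in> carrier ?P" using subgroup_nat_pow_closed[OF P x(1)] by simp
    have "?\<phi> w = ?\<phi> (x [^] i) \<otimes>\<^bsub>?F\<^esub> ?\<phi> q"
      using h.hom_mult[OF xi, of q] i by simp
    also have "?\<phi> q = \<one>\<^bsub>?F\<^esub>" using ker[of q] i(1) by blast
    also have "?\<phi> (x [^] i) \<otimes>\<^bsub>?F\<^esub> \<one>\<^bsub>?F\<^esub> = ?\<phi> (x [^] i)"
      using h.hom_closed[OF xi] by (rule h.H.r_one)
    also have "\<dots> = ?\<phi> x [^]\<^bsub>?F\<^esub> i"
      using h.hom_nat_pow[of x i] x(1) by (simp add: nat_pow_consistent[symmetric])
    finally show ?thesis by blast
  qed
  have xF: "?\<phi> x \<in> carrier ?F" using h.hom_closed[of x] x(1) by simp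
  have "w [^] p \<in> M" if w: "w \<in> P" for w
  proof -
    obtain i :: nat where i: "?\<phi> w = ?\<phi> x [^]\<^bsub>?F\<^esub> i" using \<phi>_pow[OF w] by blast
    have wp: "w [^] p \<in> P" "x [^] p \<in> P" using subgroup_nat_pow_closed[OF P] w x by auto
    have xp: "?\<phi> x [^]\<^bsub>?F\<^esub> p = \<one>\<^bsub>?F\<^esub>"
    proof -
      have "?\<phi> x [^]\<^bsub>?F\<^esub> p = ?\<phi> (x [^] p)"
        using h.hom_nat_pow[of x p] x(1) by (simp add: nat_pow_consistent[symmetric])
      also have "\<dots> = \<one>\<^bsub>?F\<^esub>" using ker[OF wp(2)] wp(2) x(3) M(2) by blast
      finally show ?thesis .
    qed
    have "?\<phi> (w [^] p) = ?\<phi> w [^]\<^bsub>?F\<^esub> p"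
      using h.hom_nat_pow[of w p] w by (simp add: nat_pow_consistent[symmetric])
    also have "\<dots> = (?\<phi> x [^]\<^bsub>?F\<^esub> p) [^]\<^bsub>?F\<^esub> i"
      unfolding i h.H.nat_pow_pow[OF xF] by (simp only: mult.commute)
    also have "\<dots> = \<one>\<^bsub>?F\<^esub>" unfolding xp by (rule h.H.nat_pow_one)
    finally show ?thesis using ker[OF wp(1)] by blast
  qed
  moreover have "inv (v \<otimes> u) \<otimes> (u \<otimes> v) \<in> M" if u: "u \<in> P" and v: "v \<in> P" for u v
  proof -
    obtain i :: nat where i: "?\<phi> u = ?\<phi> x [^]\<^bsub>?F\<^esub> i" using \<phi>_pow[OF u] by blast
    obtain j :: nat where j: "?\<phi> v = ?\<phi> x [^]\<^bsub>?F\<^esub> j" using \<phi>_pow[OF v] by blast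
    have uv: "u \<otimes> v \<in> P" "v \<otimes> u \<in> P" using u v subgroup.m_closed[OF P] by auto
    then have iv: "inv (v \<otimes> u) \<in> P" using subgroup.m_inv_closed[OF P] by blast
    have c: "inv (v \<otimes> u) \<otimes> (u \<otimes> v) \<in> P" using subgroup.m_closed[OF P iv uv(1)] .
    have "?\<phi> (u \<otimes> v) = ?\<phi> u \<otimes>\<^bsub>?F\<^esub> ?\<phi> v" using h.hom_mult[of u v] u v by simp
    also have "\<dots> = ?\<phi> v \<otimes>\<^bsub>?F\<^esub> ?\<phi> u"
      unfolding i j using h.H.nat_pow_mult[OF xF] by (simp only: add.commute)
    also have "\<dots> = ?\<phi> (v \<otimes> u)" using h.hom_mult[of v u] u v by simp
    finally have eq: "?\<phi> (u \<otimes> v) = ?\<phi> (v \<otimes> u)" .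
    have "?\<phi> (inv (v \<otimes> u) \<otimes> (u \<otimes> v)) = ?\<phi> (inv (v \<otimes> u)) \<otimes>\<^bsub>?F\<^esub> ?\<phi> (u \<otimes> v)"
      using h.hom_mult[of "inv (v \<otimes> u)" "u \<otimes> v"] iv uv by simp
    also have "\<dots> = ?\<phi> (inv (v \<otimes> u) \<otimes> (v \<otimes> u))"
      unfolding eq using h.hom_mult[of "inv (v \<otimes> u)" "v \<otimes> u"] iv uv by simp
    also have "\<dots> = \<one>\<^bsub>?F\<^esub>"
      using ker[of \<one>] subgroup.one_closed[OF Q] subgroup.one_closed[OF P] uv P_carrier by auto
    finally show ?thesis using ker[OF c] by blast
  qed
  ultimately show thesis using that M card_eq by blast
qed

text \<open>Otherwise some iterated \<open>p\<close>-th power of \<open>w\<close>, after at least one step, is an \<open>x\<close> outside \<open>\<Phi>\<close> with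
  \<open>x [^] p\<close> in \<open>\<Phi>\<close>. This \<open>x\<close> is a \<open>p\<close>-th power, so it lies in the subgroup \<open>M\<close> that should avoid it.\<close>

lemma pow_p_in_Frat:
  assumes w: "w \<in> P"
  shows "w [^] p \<in> \<Phi>"
proof (rule ccontr)
  assume contra: "w [^] p \<notin> \<Phi>"
  have wC: "w \<in> carrier G" using w P_carrier by blast
  \<comment> \<open>Here \<open>?j\<close> is at least two, so the last power outside \<open>\<Phi>\<close> is itself a \<open>p\<close>-th power.\<close>
  let ?j = "LEAST j. w [^] (p ^ j) \<in> \<Phi>"
  have "w [^] (p ^ a) \<in> \<Phi>"
    using pow_card_subgroup_eq_one[OF P w] card_P subgroup.one_closed[OF Frat_subgroup] by simp
  then have j: "w [^] (p ^ ?j) \<in> \<Phi>" by (rule LeastI)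
  have "w \<notin> \<Phi>" using contra subgroup_nat_pow_closed[OF Frat_subgroup] by blast
  then have "?j \<noteq> 0" using j wC by (metis nat_pow_eone power_0)
  moreover have "?j \<noteq> 1" using j contra by (metis power_one_right)
  ultimately obtain i where i: "?j = Suc (Suc i)" by (metis One_nat_def not0_implies_Suc)
  let ?x = "w [^] (p ^ Suc i)"
  have "?x \<notin> \<Phi>" using not_less_Least[of "Suc i" "\<lambda>j. w [^] (p ^ j) \<in> \<Phi>"] i by simp
  moreover have "?x [^] p \<in> \<Phi>" using j wC by (simp add: i nat_pow_pow mult.commute)
  moreover have xP: "?x \<in> P" using subgroup_nat_pow_closed[OF P w] .
  ultimately obtain M where "?x \<notin> M" "\<And>w. w \<in> P \<Longrightarrow> w [^] p \<in> M"
    using maximal_trace by metis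
  moreover have "(w [^] (p ^ i)) [^] p = ?x" using wC by (simp add: nat_pow_pow mult.commute)
  ultimately show False using subgroup_nat_pow_closed[OF P w] by metis
qed

text \<open>A commutator \<open>c\<close> outside \<open>\<Phi>\<close> would, like a \<open>p\<close>-th power, lie in the subgroup \<open>M\<close> belonging to it.\<close>

lemma commutator_in_Frat:
  assumes "u \<in> P" and "v \<in> P"
  shows "inv (v \<otimes> u) \<otimes> (u \<otimes> v) \<in> \<Phi>"
proof (rule ccontr)
  let ?c = "inv (v \<otimes> u) \<otimes> (u \<otimes> v)"
  assume "?c \<notin> \<Phi>"
  moreover have c: "?c \<in> P"
    using assms subgroup.m_closed[OF P] subgroup.m_inv_closed[OF P] by blast
  ultimately obtain M where "?c \<notin> M"
    "\<And>u v. u \<in> P \<Longrightarrow> v \<in> P \<Longrightarrow> inv (v \<otimes> u) \<otimes> (u \<otimes> v) \<in> M"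
    using maximal_trace[OF c _ pow_p_in_Frat[OF c]] by metis
  then show False using assms by blast
qed

text \<open>Each \<open>w\<close> in \<open>P\<close> lies in a cyclic group \<open>\<langle>x\<rangle>\<close> with \<open>x\<close> outside \<open>\<Phi>\<close>, and every such group contains \<open>\<Phi>\<close>.\<close>

lemma Frat_central:
  assumes "z \<in> \<Phi>" and w: "w \<in> P"
  shows "z \<otimes> w = w \<otimes> z"
proof -
  obtain x where x: "x \<in> P" "x \<notin> \<Phi>" "w \<in> generate G {x}"
  proof (cases "w \<in> \<Phi>")
    case True
    obtain x where x: "x \<in> P" "x \<notin> \<Phi>" by (rule exists_outside_Frat)
    then have "\<Phi> \<subseteq> generate G {x}"
      using root_of_Frat(2)[of x] pow_p_in_Frat P_carrier by blast
    then show thesis using that x True by blast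
  next
    case False
    then show thesis using that[of w] w generate_single_subgroup(2) P_carrier by blast
  qed
  have xC: "x \<in> carrier G" using x P_carrier by blast
  have "\<Phi> \<subseteq> generate G {x}" using root_of_Frat(2)[OF xC x(2) pow_p_in_Frat[OF x(1)]] .
  then show ?thesis using generate_single_commute[OF finite xC _ x(3)] assms by blast
qed

text \<open>Both \<open>x [^] p\<close> and \<open>y [^] p\<close> generate \<open>\<Phi>\<close>, so some \<open>v\<close> in \<open>\<langle>x\<rangle>\<close> has \<open>v [^] p\<close> inverse to \<open>y [^] p\<close>.
  Then \<open>(v \<otimes> y) [^] p = c [^] (p choose 2)\<close> for the commutator \<open>c\<close> of \<open>y\<close> and \<open>v\<close>, and \<open>c [^] p = \<one>\<close>
  because \<open>y [^] p\<close> is central. As \<open>v \<otimes> y\<close> is outside \<open>\<Phi>\<close>, its \<open>p\<close>-th power is not trivial: so \<open>p\<close> does not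
  divide \<open>p choose 2\<close>, and \<open>c\<close> is not trivial. The order \<open>p ^ k\<close> of \<open>v \<otimes> y\<close> then divides four.\<close>

lemma noncyclic_sylow:
  assumes x: "x \<in> P" "x \<notin> \<Phi>" and y: "y \<in> P" "y \<notin> generate G {x}"
  shows "p = 2" and "k = 2" and "x \<otimes> y \<noteq> y \<otimes> x"
proof -
  let ?X = "generate G {x}"
  have xC: "x \<in> carrier G" and yC: "y \<in> carrier G" using x y P_carrier by auto
  note X = generate_single_subgroup[OF xC]
  have FX: "\<Phi> \<subseteq> ?X" using root_of_Frat(2)[OF xC x(2) pow_p_in_Frat[OF x(1)]] .
  have "y [^] p \<in> generate G {x [^] p}"
    using root_of_Frat(3)[OF xC x(2) pow_p_in_Frat[OF x(1)]] pow_p_in_Frat[OF y(1)] by simp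
  then obtain j :: nat where j: "y [^] p = (x [^] p) [^] j"
    using mem_generate_single_iff[OF finite, of "x [^] p"] xC by auto
  define v where "v = inv (x [^] j)"
  have vX: "v \<in> ?X"
    unfolding v_def using subgroup.m_inv_closed[OF X(1) subgroup_nat_pow_closed[OF X]] .
  have vP: "v \<in> P"
    unfolding v_def using subgroup.m_inv_closed[OF P subgroup_nat_pow_closed[OF P x(1)]] .
  have vC: "v \<in> carrier G" using vP P_carrier by blast
  have vp: "v [^] p = inv (y [^] p)"
    unfolding v_def j using xC by (simp add: nat_pow_inv nat_pow_pow mult.commute)
  define c where "c = inv (v \<otimes> y) \<otimes> (y \<otimes> v)"
  have cF: "c \<in> \<Phi>" unfolding c_def using commutator_in_Frat[OF y(1) vP] .
  have cC: "c \<in> carrier G" using cF Frat_carrier by blast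
  have yv: "y \<otimes> v = v \<otimes> y \<otimes> c"
    unfolding c_def using yC vC by (simp add: mult_inv_cancel_left)
  note pow = pow_mult_commutator[OF vC yC cC yv Frat_central[OF cF vP] Frat_central[OF cF y(1)]]
  let ?u = "v \<otimes> y"
  have uP: "?u \<in> P" using subgroup.m_closed[OF P vP y(1)] .
  have uC: "?u \<in> carrier G" using uP P_carrier by blast
  have "?u \<notin> ?X"
  proof
    assume "?u \<in> ?X"
    then have "inv v \<otimes> ?u \<in> ?X"
      using subgroup.m_closed[OF X(1)] subgroup.m_inv_closed[OF X(1) vX] by blast
    then show False using y(2) vC yC by (simp add: mult_inv_cancel_left)
  qed
  then have uF: "?u \<notin> \<Phi>" using FX by blast
  have ord_u: "ord ?u = p ^ k" using root_of_Frat(1)[OF uC uF pow_p_in_Frat[OF uP]] .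
  have u_ne: "?u [^] p \<noteq> \<one>"
    using exponent_p_in_Frat[OF uC] uF by blast
  have up: "?u [^] p = c [^] (p choose 2)"
    using pow(2)[of p] vp yC cC by simp
  have cp: "c [^] p = \<one>"
  proof -
    have "v \<otimes> y [^] p \<otimes> c [^] p = y [^] p \<otimes> v" using pow(1)[of p] by simp
    also have "\<dots> = v \<otimes> y [^] p" using Frat_central[OF pow_p_in_Frat[OF y(1)] vP] .
    finally show ?thesis using vC yC cC by (metis l_cancel_one m_closed nat_pow_closed)
  qed
  show p2: "p = 2"
  proof (rule ccontr)
    assume "p \<noteq> 2"
    then have "p dvd (p choose 2)" using prime p_gt_1 by (intro dvd_choose_prime) auto
    then obtain b where "p choose 2 = p * b" by (auto elim: dvdE)
    then have "?u [^] p = (c [^] p) [^] b" using up cC by (simp add: nat_pow_pow)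
    then show False using u_ne cp by simp
  qed
  have u2: "?u [^] p = c" using up p2 cC by simp
  have "?u [^] (p ^ 2) = (?u [^] p) [^] p" using uC by (simp add: nat_pow_pow power2_eq_square)
  also have "\<dots> = \<one>" unfolding u2 by (rule cp)
  finally have "p ^ k dvd p ^ 2" using ord_u uC by (simp add: pow_eq_id)
  then have "k \<le> 2" using p_gt_1 by (auto dest: power_dvd_imp_le)
  then show "k = 2" using two_le_k by simp
  show "x \<otimes> y \<noteq> y \<otimes> x"
  proof
    assume "x \<otimes> y = y \<otimes> x"
    then have "x [^] j \<otimes> y = y \<otimes> x [^] j" using nat_pow_commute xC yC by blast
    then have "v \<otimes> y = y \<otimes> v"
      unfolding v_def using xC yC by (metis inv_solve_left inv_solve_right m_assoc nat_pow_closed m_closed inv_closed)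
    then have "c = \<one>" unfolding c_def using vC yC by simp
    then show False using u_ne u2 by simp
  qed
qed

section \<open>Cyclic and noncyclic Sylow subgroups\<close>

text \<open>Let \<open>Z\<close> be the subgroup of order \<open>p\<close>. Its centralizer \<open>C\<close> contains the abelian group \<open>P\<close>, and all elements of
  order \<open>p\<close> in \<open>P\<close> are central in \<open>C\<close>; so \<open>C = P\<close>. Hence \<open>P\<close> is normal and is the kernel of the action
  on \<open>Z\<close>, which has values in a cyclic group of order \<open>p - 1\<close>.\<close>

lemma cyclic_sylow_case:
  assumes x: "x \<in> P" "x \<notin> \<Phi>" and Px: "P = generate G {x}"
  shows "\<exists>H. semidirect_decomp H P G \<and>
           (\<exists>S. subgroup S (integer_mod_group (p - 1)) \<and>
              G\<lparr>carrier := H\<rparr> \<cong> (integer_mod_group (p - 1))\<lparr>carrier := S\<rparr>)"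
    and "P = centralizer G P" and "G\<lparr>carrier := P\<rparr> \<cong> integer_mod_group (p ^ k)"
proof -
  have xC: "x \<in> carrier G" using x P_carrier by blast
  note xroot = xC x(2) pow_p_in_Frat[OF x(1)]
  define z where "z = x [^] (p ^ (k - 1))"
  let ?Z = "generate G {z}"
  have zC: "z \<in> carrier G" and ordz: "ord z = p"
    and Z: "?Z = {g \<in> carrier G. g [^] p = \<one>}"
    using order_p_subgroup[OF xroot] unfolding z_def by blast+
  have conj: "g \<otimes> w \<otimes> inv g \<in> ?Z" if "g \<in> carrier G" "w \<in> ?Z" for g w
    using that unfolding Z by (auto simp: conjugate_nat_pow)
  have zZ: "z \<in> ?Z" using generate_single_subgroup(2)[OF zC] .
  have ZC: "?Z \<subseteq> carrier G" using Z by auto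
  have ZP: "?Z \<subseteq> P" using Z exponent_p_in_Frat Frat_subset_P by blast
  have comm: "a \<otimes> b = b \<otimes> a" if "a \<in> P" "b \<in> P" for a b
    using generate_single_commute[OF finite xC] that Px by blast
  let ?C = "centralizer G ?Z"
  have C: "?C \<lhd> G" using centralizer_normal[OF ZC conj] .
  have CG: "subgroup ?C G" using C by (rule normal_imp_subgroup)
  have PC: "P \<subseteq> ?C" using P_carrier comm ZP by (auto simp: centralizer_def)
  obtain n where n: "card ?C = card P * n"
    using card_subgroup_dvd_card_subgroup[OF P CG PC] by (auto elim: dvdE)
  have "card P * n dvd card P * m"
    using card_subgroup_dvd_order[OF CG] n order_eq card_P by simp
  then have "n dvd m" using card_P p_gt_1 by simp
  then have "\<not> p dvd n" using not_dvd dvd_trans by blast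
  then have cop: "coprime n p" using prime_imp_coprime[OF prime] coprime_commute by blast
  have "g \<otimes> w = w \<otimes> g" if w: "w \<in> P" "w [^] p = \<one>" and g: "g \<in> ?C" for w g
  proof -
    have "w \<in> ?Z" using w P_carrier unfolding Z by blast
    then show ?thesis using g unfolding centralizer_def by blast
  qed
  then have CP: "?C = P"
    using normal_subgroup_eq_if_trivial_p_prime_core[OF finite core prime C P PC comm card_P n cop]
    by blast
  have cent: "g \<in> P \<longleftrightarrow> g \<otimes> z = z \<otimes> g" if g: "g \<in> carrier G" for g
  proof
    assume "g \<in> P"
    then have "g \<in> ?C" using CP by simp
    then show "g \<otimes> z = z \<otimes> g" using zZ unfolding centralizer_def by blast
  next
    assume gz: "g \<otimes> z = z \<otimes> g"
    have "g \<otimes> w = w \<otimes> g" if w: "w \<in> ?Z" for w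
    proof -
      obtain i :: nat where "w = z [^] i" using w mem_generate_single_iff[OF finite zC] by blast
      then show ?thesis using nat_pow_commute[OF zC g gz[symmetric], of i] by simp
    qed
    then have "g \<in> ?C" using g by (simp add: centralizer_def)
    then show "g \<in> P" using CP by simp
  qed
  have "g \<otimes> z \<otimes> inv g \<in> ?Z" if "g \<in> carrier G" for g using conj[OF that zZ] .
  then obtain \<alpha> where \<alpha>: "\<alpha> \<in> hom G (integer_mod_group (p - 1))"
    and ker: "\<And>g. g \<in> carrier G \<Longrightarrow> \<alpha> g = 0 \<longleftrightarrow> g \<otimes> z = z \<otimes> g"
    using hom_of_action_on_prime_order_subgroup[OF finite prime zC ordz] by metis
  have nP: "P \<lhd> G" using C CP by simp
  have "coprime (card P) m" using prime not_dvd card_P by (simp add: prime_imp_coprime)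
  moreover have "order G = card P * m" using order_eq card_P by simp
  moreover have "p - 1 > 0" using p_gt_1 by simp
  moreover have "\<alpha> g = 0 \<longleftrightarrow> g \<in> P" if "g \<in> carrier G" for g using ker[OF that] cent[OF that] by simp
  ultimately show "\<exists>H. semidirect_decomp H P G \<and>
           (\<exists>S. subgroup S (integer_mod_group (p - 1)) \<and>
              G\<lparr>carrier := H\<rparr> \<cong> (integer_mod_group (p - 1))\<lparr>carrier := S\<rparr>)"
    using cyclic_coprime_complement[OF finite _ \<alpha> nP] by blast
  show "P = centralizer G P"
  proof
    show "P \<subseteq> centralizer G P" using P_carrier comm by (auto simp: centralizer_def)
    show "centralizer G P \<subseteq> P" using ZP CP by (auto simp: centralizer_def)
  qed
  show "G\<lparr>carrier := P\<rparr> \<cong> integer_mod_group (p ^ k)"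
    using generate_single_iso_integer_mod_group[OF finite xC] root_of_Frat(1)[OF xroot] Px by simp
qed

text \<open>Any two commuting elements of \<open>P\<close>, the first outside \<open>\<Phi>\<close>, are dependent modulo \<open>\<Phi>\<close>; and all commutators lie in
  \<open>\<Phi> = {\<one>, z}\<close>. So two elements that do not commute with \<open>x\<close> have a product in \<open>\<langle>x\<rangle>\<close>, which
  leaves only eight elements in \<open>P\<close>. The subgroup \<open>M\<close> that avoids \<open>x\<close> has index two, its Sylow subgroup
  \<open>P \<inter> M\<close> is cyclic of order four, and its only involution \<open>z\<close> is central. So \<open>M\<close> equals \<open>P \<inter> M\<close>, and the
  whole group has order eight.\<close>

lemma noncyclic_sylow_case:
  assumes x: "x \<in> P" "x \<notin> \<Phi>" and y: "y \<in> P" "y \<notin> generate G {x}"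
  shows "p = 2" and "k = 2" and "G \<cong> Q8"
proof -
  show p2: "p = 2" and k2: "k = 2" using noncyclic_sylow[OF x y] by auto
  let ?X = "generate G {x}"
  have xC: "x \<in> carrier G" and yC: "y \<in> carrier G" using x y P_carrier by auto
  note X = generate_single_subgroup[OF xC]
  note xroot = xC x(2) pow_p_in_Frat[OF x(1)]
  have FX: "\<Phi> \<subseteq> ?X" using root_of_Frat(2)[OF xroot] .
  have yF: "y \<notin> \<Phi>" using FX y(2) by blast
  define z where "z = x [^] p"
  have zF: "z \<in> \<Phi>" using xroot(3) by (simp add: z_def)
  have zC: "z \<in> carrier G" using zF Frat_carrier by blast
  have ne1: "w [^] p \<noteq> \<one>" if "w \<in> P" "w \<notin> \<Phi>" for w
    using exponent_p_in_Frat that P_carrier by blast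
  have finF: "Finite_Set.finite \<Phi>" using Frat_carrier finite finite_subset by blast
  have z1: "z \<noteq> \<one>" using ne1[OF x] by (simp add: z_def)
  have cardF: "card \<Phi> = 2" using card_Frat p2 k2 by simp
  have "{\<one>, z} \<subseteq> \<Phi>" using zF subgroup.one_closed[OF Frat_subgroup] by blast
  then have F: "\<Phi> = {\<one>, z}" using card_seteq[OF finF, of "{\<one>, z}"] cardF z1 by simp
  have pow2: "w [^] p = w \<otimes> w" if "w \<in> carrier G" for w
    using that by (simp add: p2 numeral_2_eq_2)
  have square: "w \<otimes> w = z" if "w \<in> P" "w \<notin> \<Phi>" for w
    using pow_p_in_Frat[OF that(1)] ne1[OF that] F pow2[of w] that P_carrier by auto
  have zz: "z \<otimes> z = \<one>"
    using pow_card_subgroup_eq_one[OF Frat_subgroup zF] cardF pow2[OF zC] p2 by simp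
  have zP: "z \<otimes> w = w \<otimes> z" if "w \<in> P" for w using Frat_central[OF zF that] .
  have swap: "x \<otimes> w = w \<otimes> x \<otimes> z" if w: "w \<in> P" "w \<notin> ?X" for w
  proof -
    have wC: "w \<in> carrier G" using w P_carrier by blast
    let ?c = "inv (w \<otimes> x) \<otimes> (x \<otimes> w)"
    have eq: "x \<otimes> w = w \<otimes> x \<otimes> ?c" using xC wC by (simp add: mult_inv_cancel_left)
    moreover have "?c \<noteq> \<one>" using eq noncyclic_sylow(3)[OF x w] xC wC by auto
    ultimately show ?thesis using commutator_in_Frat[OF x(1) w(1)] F by auto
  qed
  have cosets: "w \<otimes> y \<in> ?X" if w: "w \<in> P" "w \<notin> ?X" for w
  proof (rule ccontr)
    \<comment> \<open>Both \<open>w\<close> and \<open>y\<close> multiply \<open>x\<close> by \<open>z\<close> under conjugation, so \<open>w \<otimes> y\<close> commutes with \<open>x\<close>.\<close>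
    assume out: "w \<otimes> y \<notin> ?X"
    have wC: "w \<in> carrier G" using w P_carrier by blast
    have wy: "w \<otimes> y \<in> P" using subgroup.m_closed[OF P w(1) y(1)] .
    have "x \<otimes> (w \<otimes> y) = (x \<otimes> w) \<otimes> y" using xC wC yC by (simp add: m_assoc)
    also have "\<dots> = w \<otimes> (x \<otimes> (z \<otimes> y))"
      unfolding swap[OF w] using xC wC yC zC by (simp add: m_assoc)
    also have "\<dots> = w \<otimes> (x \<otimes> y \<otimes> z)"
      unfolding zP[OF y(1)] using xC wC yC zC by (simp add: m_assoc)
    also have "\<dots> = w \<otimes> y \<otimes> x"
      unfolding swap[OF y] using xC wC yC zC zz by (simp add: m_assoc)
    finally show False using noncyclic_sylow(3)[OF x wy out] by simp
  qed
  have X_list: "?X \<subseteq> {\<one>, x, z, z \<otimes> x}"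
  proof
    fix w assume "w \<in> ?X"
    then obtain i :: nat where i: "w = x [^] i" using mem_generate_single_iff[OF finite xC] by blast
    have ordx: "ord x = 4" using root_of_Frat(1)[OF xroot] p2 k2 by simp
    have "w = x [^] (i mod 4)"
      using nat_pow_mod[OF xC pow_ord_eq_1[OF xC], of i] i ordx by simp
    moreover have "i mod 4 \<in> {0, 1, 2, 3}" by auto
    moreover have "x [^] (2::nat) = z" using p2 by (simp add: z_def)
    moreover have "x [^] (3::nat) = x [^] (2::nat) \<otimes> x"
      by (simp add: numeral_3_eq_3 numeral_2_eq_2)
    ultimately show "w \<in> {\<one>, x, z, z \<otimes> x}" using xC by auto
  qed
  let ?L = "{\<one>, z, x, z \<otimes> x, y, z \<otimes> y, x \<otimes> y, z \<otimes> (x \<otimes> y)}"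
  have P_list: "P \<subseteq> ?L"
  proof
    fix w assume w: "w \<in> P"
    show "w \<in> ?L"
    proof (cases "w \<in> ?X")
      case True
      then show ?thesis using X_list by blast
    next
      case False
      have wC: "w \<in> carrier G" using w P_carrier by blast
      have "z \<in> ?X" using FX zF by blast
      then have "z \<otimes> (w \<otimes> y) \<in> ?X" using cosets[OF w False] subgroup.m_closed[OF X(1)] by blast
      moreover have "w = z \<otimes> (w \<otimes> y) \<otimes> y"
      proof -
        have "z \<otimes> (w \<otimes> y) \<otimes> y = (z \<otimes> w) \<otimes> (y \<otimes> y)" using wC yC zC by (simp add: m_assoc)
        also have "\<dots> = w \<otimes> (z \<otimes> z)"
          unfolding zP[OF w] square[OF y(1) yF] using wC zC by (simp add: m_assoc)
        finally show ?thesis using zz wC by simp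
      qed
      ultimately obtain t where "t \<in> {\<one>, x, z, z \<otimes> x}" "w = t \<otimes> y" using X_list by blast
      then show ?thesis using xC yC zC by (auto simp: m_assoc)
    qed
  qed
  have card_X: "card ?X = 4"
    using generate_pow_card[OF xC] root_of_Frat(1)[OF xroot] p2 k2 by simp
  have a3: "a = 3"
  proof -
    have "card P \<le> card ?L" using P_list by (intro card_mono) auto
    also have "\<dots> \<le> 8"
      using card_length[of "[\<one>, z, x, z \<otimes> x, y, z \<otimes> y, x \<otimes> y, z \<otimes> (x \<otimes> y)]"] by simp
    finally have "(2::nat) ^ a \<le> 2 ^ 3" using card_P p2 by simp
    then have le: "a \<le> 3" by (rule power_le_imp_le_exp[rotated]) simp
    have "?X \<subset> P" using generate_single_subset_iff[OF P xC] x y by blast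
    then have "card ?X < card P" by (rule psubset_card_mono[OF finite_P])
    then have "(2::nat) ^ 2 < 2 ^ a" using card_X card_P p2 by simp
    then have "2 < a" by (rule power_less_imp_less_exp[rotated]) simp
    then show ?thesis using le by simp
  qed
  have card_P8: "card P = 8" using card_P p2 a3 by simp
  obtain M where M: "subgroup M G" "\<Phi> \<subseteq> M" "x \<notin> M" "?X <#> M = carrier G"
    "card P = p * card (P \<inter> M)"
    by (rule maximal_trace[OF x pow_p_in_Frat[OF x(1)]]) (rule that)
  have MC: "M \<subseteq> carrier G" using M(1) by (rule subgroup.subset)
  have split: "g \<in> M \<or> inv x \<otimes> g \<in> M" if g: "g \<in> carrier G" for g
  proof -
    have "g \<in> ?X <#> M" using M(4) g by simp
    then obtain t n where t: "t \<in> ?X" "n \<in> M" "g = t \<otimes> n" by (auto simp: set_mult_def)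
    have nC: "n \<in> carrier G" using t MC by blast
    have zM: "z \<in> M" using zF M(2) by blast
    have zn: "z \<otimes> n \<in> M" using subgroup.m_closed[OF M(1) zM t(2)] .
    have "z \<otimes> x \<otimes> n = x \<otimes> (z \<otimes> n)"
      unfolding zP[OF x(1)] using xC nC zC by (simp add: m_assoc)
    then have cancel: "inv x \<otimes> (x \<otimes> n) = n" "inv x \<otimes> (z \<otimes> x \<otimes> n) = z \<otimes> n"
      using xC nC zC by (simp_all add: mult_inv_cancel_left)
    have "t = \<one> \<or> t = x \<or> t = z \<or> t = z \<otimes> x" using X_list t(1) by blast
    then show ?thesis using t(2,3) zn nC cancel by (elim disjE) simp_all
  qed
  have M_normal: "M \<lhd> G"
  proof (rule normal_invI[OF M(1)])
    have conj_x: "x \<otimes> n \<otimes> inv x \<in> M" if n: "n \<in> M" for n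
    proof (rule ccontr)
      assume out: "x \<otimes> n \<otimes> inv x \<notin> M"
      have nC: "n \<in> carrier G" using n MC by blast
      have "n \<otimes> inv x \<in> M"
        using split[of "x \<otimes> n \<otimes> inv x"] out xC nC by (simp add: m_assoc mult_inv_cancel_left)
      then have "inv n \<otimes> (n \<otimes> inv x) \<in> M"
        using subgroup.m_closed[OF M(1)] subgroup.m_inv_closed[OF M(1) n] by blast
      then have "inv x \<in> M" using xC nC by (simp add: mult_inv_cancel_left)
      then show False using M(3) subgroup.m_inv_closed[OF M(1)] xC by fastforce
    qed
    fix g n assume g: "g \<in> carrier G" and n: "n \<in> M"
    have nC: "n \<in> carrier G" using n MC by blast
    have conj_M: "h \<otimes> n \<otimes> inv h \<in> M" if "h \<in> M" for h
      using that n subgroup.m_closed[OF M(1)] subgroup.m_inv_closed[OF M(1)] by blast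
    from split[OF g] show "g \<otimes> n \<otimes> inv g \<in> M"
    proof
      assume "inv x \<otimes> g \<in> M"
      then have "x \<otimes> (inv x \<otimes> g \<otimes> n \<otimes> inv (inv x \<otimes> g)) \<otimes> inv x \<in> M" using conj_x conj_M by blast
      then show ?thesis using g xC nC by (simp add: m_assoc inv_mult_group mult_inv_cancel_left)
    qed (rule conj_M)
  qed
  have card_M: "order G = 2 * card M"
  proof -
    have finM: "Finite_Set.finite M" using MC finite finite_subset by blast
    have "carrier G \<subseteq> M \<union> (\<lambda>g. x \<otimes> g) ` M"
    proof
      fix g assume g: "g \<in> carrier G"
      have "g = x \<otimes> (inv x \<otimes> g)" using xC g by (simp add: mult_inv_cancel_left)
      then show "g \<in> M \<union> (\<lambda>g. x \<otimes> g) ` M" using split[OF g] by blast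
    qed
    then have "order G \<le> card (M \<union> (\<lambda>g. x \<otimes> g) ` M)"
      unfolding order_def using finM by (intro card_mono) auto
    also have "\<dots> \<le> card M + card M"
      using card_Un_le[of M "(\<lambda>g. x \<otimes> g) ` M"] card_image_le[OF finM, of "\<lambda>g. x \<otimes> g"] by linarith
    finally have le: "order G \<le> 2 * card M" by simp
    obtain b where b: "order G = card M * b" using card_subgroup_dvd_order[OF M(1)] by (auto elim: dvdE)
    have "M \<subset> carrier G" using MC M(3) xC by blast
    then have "card M < order G" unfolding order_def using psubset_card_mono[OF finite] by blast
    then have "b \<noteq> 0" "b \<noteq> 1" using b by (intro notI; simp)+
    then have "2 \<le> b" by linarith
    then have "2 * card M \<le> order G" unfolding b by simp
    with le show ?thesis by (rule le_antisym)
  qed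
  let ?Q = "P \<inter> M"
  have Q: "subgroup ?Q G" using P M(1) by (rule subgroups_Inter_pair)
  have card_Q: "card ?Q = 2 ^ 2" using M(5) card_P8 p2 by simp
  have finQ: "Finite_Set.finite ?Q" using finite_P by blast
  have "\<not> ?Q \<subseteq> \<Phi>" using card_mono[OF finF, of ?Q] card_Q cardF by auto
  then obtain y' where y': "y' \<in> P" "y' \<in> M" "y' \<notin> \<Phi>" by blast
  have y'C: "y' \<in> carrier G" using y' P_carrier by blast
  have "generate G {y'} \<subseteq> ?Q" using generate_single_subset_iff[OF Q y'C] y' by blast
  moreover have "card (generate G {y'}) = 4"
    using generate_pow_card[OF y'C] root_of_Frat(1)[OF y'C y'(3) pow_p_in_Frat[OF y'(1)]] p2 k2 by simp
  ultimately have Qy: "generate G {y'} = ?Q" using card_subset_eq[OF finQ] card_Q by simp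
  have z_central: "g \<otimes> w = w \<otimes> g" if w: "w \<in> ?Q" "w [^] p = \<one>" and g: "g \<in> M" for w g
  proof -
    have gC: "g \<in> carrier G" using g MC by blast
    have wC: "w \<in> carrier G" using w P_carrier by blast
    have wF: "w \<in> \<Phi>" using exponent_p_in_Frat[OF wC w(2)] .
    have conjF: "g \<otimes> w \<otimes> inv g \<in> \<Phi>" using normal.inv_op_closed2[OF frattini_normal gC wF] .
    have "g \<otimes> w \<otimes> inv g = w"
    proof (cases "w = \<one>")
      case False
      have "g \<otimes> w \<otimes> inv g \<noteq> \<one>"
      proof
        assume "g \<otimes> w \<otimes> inv g = \<one>"
        then have "inv g \<otimes> (g \<otimes> w \<otimes> inv g) \<otimes> g = \<one>" using gC by simp
        then show False using False gC wC by (simp add: m_assoc mult_inv_cancel_left)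
      qed
      then show ?thesis using conjF wF False F by auto
    qed (use gC in simp)
    then have "g \<otimes> w \<otimes> inv g \<otimes> g = w \<otimes> g" by simp
    then show ?thesis using gC wC by (simp add: m_assoc)
  qed
  have "card M = card ?Q * m" using card_M order_eq card_P card_P8 card_Q by simp
  moreover have "coprime m p" using prime_imp_coprime[OF prime not_dvd] coprime_commute by blast
  moreover have "u \<otimes> v = v \<otimes> u" if "u \<in> ?Q" "v \<in> ?Q" for u v
    using generate_single_commute[OF finite y'C] that Qy by blast
  moreover have "card ?Q = p ^ 2" using card_Q p2 by simp
  ultimately have "M = ?Q"
    using normal_subgroup_eq_if_trivial_p_prime_core[OF finite core prime M_normal Q] z_central
    by blast
  then have "card M = 4" using card_Q by simp
  then have order8: "card (carrier G) = 8" using card_M by (simp add: order_def)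
  then have "carrier G = P" using card_seteq[OF finite P_carrier] card_P8 by simp
  then have "carrier G \<subseteq> ?L" using P_list by simp
  moreover have "x \<otimes> x = z" using square[OF x] .
  moreover have "y \<otimes> y = z" using square[OF y(1) yF] .
  moreover have "y \<otimes> x = z \<otimes> (x \<otimes> y)"
  proof -
    have "z \<otimes> (x \<otimes> y) = z \<otimes> (z \<otimes> (y \<otimes> x))"
      unfolding swap[OF y] zP[OF subgroup.m_closed[OF P y(1) x(1)]] ..
    also have "\<dots> = y \<otimes> x" using zz xC yC zC by (simp flip: m_assoc)
    finally show ?thesis by simp
  qed
  ultimately show "G \<cong> Q8" using iso_Q8I[OF xC yC zC _ _ zz _ order8] by blast
qed

end

lemma (in critical_group) cyclic_or_quaternion:
  "(\<exists>H P. semidirect_decomp H P G \<and>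
      (\<exists>S. subgroup S (integer_mod_group (p - 1)) \<and>
         G\<lparr>carrier := H\<rparr> \<cong> (integer_mod_group (p - 1))\<lparr>carrier := S\<rparr>) \<and>
      P = centralizer G P \<and> G\<lparr>carrier := P\<rparr> \<cong> integer_mod_group (p ^ k))
   \<or> p ^ k = 2 ^ 2 \<and> G \<cong> Q8"
proof -
  have "order G \<noteq> 0" using finite order_gt_0_iff_finite by simp
  then obtain m where m: "order G = p ^ multiplicity p (order G) * m" "\<not> p dvd m"
    using multiplicity_decompose'[of "order G" p] p_gt_1 by auto
  obtain P where P: "subgroup P G" "card P = p ^ multiplicity p (order G)"
    using sylow_thm[OF prime is_group m(1) finite] by blast
  interpret critical_sylow G p k P "multiplicity p (order G)" m
    using P m critical_group_axioms by (simp add: critical_sylow_def critical_sylow_axioms_def)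
  obtain x where x: "x \<in> P" "x \<notin> \<Phi>" by (rule exists_outside_Frat)
  have XP: "generate G {x} \<subseteq> P" using generate_single_subset_iff[OF P(1)] x P_carrier by blast
  show ?thesis
  proof (cases "P = generate G {x}")
    case True
    show ?thesis using cyclic_sylow_case[OF x True] by blast
  next
    case False
    then obtain y where y: "y \<in> P" "y \<notin> generate G {x}" using XP by blast
    show ?thesis using noncyclic_sylow_case[OF x y] by simp
  qed
qed

lemma (in group) card_semidirect_le:
  assumes "semidirect_decomp H P G" and "finite (carrier G)"
  shows "order G \<le> card H * card P"
proof -
  have HP: "H <#> P = carrier G" "subgroup H G" "subgroup P G"
    using assms normal_imp_subgroup by (auto simp: semidirect_decomp_def)
  have "finite (H \<times> P)"
    using HP(2,3) assms(2) by (meson finite_SigmaI finite_subset subgroup.subset)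
  moreover have "carrier G \<subseteq> (\<lambda>(h, u). h \<otimes> u) ` (H \<times> P)"
    unfolding HP(1)[symmetric] set_mult_def by force
  ultimately have "card (carrier G) \<le> card (H \<times> P)" by (rule surj_card_le)
  then show ?thesis by (simp add: order_def card_cartesian_product)
qed

text \<open>The two cases exclude each other by order: for \<open>p ^ k = 4\<close> the complement in the semidirect product is
  trivial, so the group has order four, while the quaternion group has order eight.\<close>

theorem theoremD:
  fixes G :: "('a, 'b) monoid_scheme" and p k :: nat
  assumes "group G" and "finite (carrier G)"
    and "Factorial_Ring.prime p" and "k > 0" and "p ^ k dvd order G"
    and "critical_type p k G"
  shows "(\<exists>H P. semidirect_decomp H P G \<and>
            (\<exists>S. subgroup S (integer_mod_group (p - 1)) \<and>
               G\<lparr>carrier := H\<rparr> \<cong> (integer_mod_group (p - 1))\<lparr>carrier := S\<rparr>) \<and>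
            P = centralizer G P \<and> G\<lparr>carrier := P\<rparr> \<cong> integer_mod_group (p ^ k))
         \<longleftrightarrow> \<not> (p ^ k = 2 ^ 2 \<and> G \<cong> Q8)" (is "?semi \<longleftrightarrow> \<not> ?quat")
proof -
  interpret critical_group G p k
    using assms by (simp add: critical_group_def critical_group_axioms_def)
  have "\<not> (?semi \<and> ?quat)"
  proof
    assume both: "?semi \<and> ?quat"
    then obtain H P S where dec: "semidirect_decomp H P G"
      and S: "subgroup S (integer_mod_group (p - 1))"
      and HS: "G\<lparr>carrier := H\<rparr> \<cong> (integer_mod_group (p - 1))\<lparr>carrier := S\<rparr>"
      and P: "G\<lparr>carrier := P\<rparr> \<cong> integer_mod_group (p ^ k)" by blast
    have four: "p ^ k = 2 ^ 2" using both by blast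
    have "p dvd 2 ^ 2" using four two_le_k by (metis dvd_power not_numeral_le_zero not_gr_zero)
    then have "p dvd 2" using prime by (rule prime_dvd_power[rotated])
    then have "p = 2" using prime by (simp add: primes_dvd_imp_eq)
    have "card S \<le> card (carrier (integer_mod_group (p - 1)))"
      using subgroup.subset[OF S] \<open>p = 2\<close> by (intro card_mono) (auto simp: carrier_integer_mod_group)
    then have "card S \<le> 1" using \<open>p = 2\<close> by (simp add: carrier_integer_mod_group)
    moreover have "card H = card S" using iso_same_card[OF HS] by simp
    moreover have "card P = 4" using iso_same_card[OF P] four by (simp add: carrier_integer_mod_group)
    moreover have "order G = 8"
      using both iso_same_card[of G Q8] order_Q8 by (simp add: order_def)
    ultimately show False using card_semidirect_le[OF dec finite] by (cases "card S") auto
  qed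
  moreover have "?semi \<or> ?quat" by (rule cyclic_or_quaternion)
  ultimately show ?thesis by blast
qed

end
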